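(* For every positive integer $n$, the bijection $\widehat{\Lambda\!\Lambda}_n:\mathrm{VHC}(\operatorname{Av}_n(312))\to\operatorname{Int}(\mathcal M_{n-1}^C)$ (defined in the context) restricts to a bijection $\mathrm{VHC}(\operatorname{Av}_n(231,312))\to\operatorname{Int}(\mathcal M_{n-1}^A)$. Furthermore, \[|\mathrm{VHC}(\operatorname{Av}_n(132,231))|=|\mathrm{VHC}(\operatorname{Av}_n(132,312))|=|\mathrm{VHC}(\operatorname{Av}_n(231,312))|=M_{n-1},\] where $M_{n-1}$ is the $(n-1)$-st Motzkin number, i.e. the number of Motzkin paths of length $n-1$.
   Context: Permutations and patterns. $S_n$ is the set of permutations of $[n]$, written $\pi=\pi_1\cdots\pi_n$; $\pi$ avoids $\tau\in S_m$ if no length-$m$ subsequence of $\pi$ has the same relative order as $\tau$; $\operatorname{Av}_n(\tau^{(1)},\dots,\tau^{(r)})$ is the set of permutations in $S_n$ avoiding all the $\tau^{(i)}$. Valid hook configurations. A descent of $\pi$ is $i\in[n-1]$ with $\pi_i>\pi_{i+1}$, and $(i,\pi_i)$ is a descent top of the plot $\{(i,\pi_i)\}$. A hook is determined by $i<j$ with $\pi_i<\pi_j$: vertical segment from $(i,\pi_i)$ up to $(i,\pi_j)$, then horizontal segment to $(j,\pi_j)$; southwest endpoint $(i,\pi_i)$, northeast endpoint $(j,\pi_j)$. If $\pi$ has descents $d_1<\cdots<d_k$, a valid hook configuration is a tuple $(H_1,\dots,H_k)$ of hooks such that (1) $H_i$ has southwest endpoint $(d_i,\pi_{d_i})$; (2)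 no point of the plot lies directly above a hook; (3) hooks do not intersect or overlap except that the northeast endpoint of one may be the southwest endpoint of another. $\mathrm{VHC}(\pi)$ is the set of these (configurations of distinct permutations are distinct; an increasing permutation, including the empty one, has exactly one, with no hooks); $\mathrm{VHC}(A)=\bigcup_{\pi\in A}\mathrm{VHC}(\pi)$. Motzkin paths and posets. A Motzkin path of length $n$ is a word over $\{U,D,E\}$ with equally many $U$'s and $D$'s such that each prefix has at least as many $U$'s as $D$'s; ${\bf M}_n$ is their set. Each $\Lambda\in{\bf M}_n$ is uniquely $X_1D^{\gamma_1}\cdots X_mD^{\gamma_m}$ with $X_j\in\{U,E\}$, $\gamma_j\ge0$; $\mathrm{cl}(\Lambda)=\{j:X_j=E\}$. $\Lambda\le_S\Lambda'$ means that for all $i$, the number of $U$'s in the first $i$ letters of $\Lambda$ is at most that of $\Lambda'$. $\Lambda\le_C\Lambda'$ means $\mathrm{cl}(\Lambda)=\mathrm{cl}(\Lambda')$ and $\Lambda\le_S\Lambda'$; $\mathcal M_n^C=({\bf M}_n,\le_C)$. $\mathcal M_n^A$ is the antichain on ${\bf M}_n$. $\operatorname{Int}(P)$ is the set of pairs $(x,y)$ of elements of a poset $P$ with $x\le y$; thus $\operatorname{Int}(\mathcal M_n^A)=\{(\Lambda,\Lambda):\Lambda\in{\bf M}_n\}$. The map $\widehat{\Lambda\!\Lambda}_n$. Let $\pi\in\operatorname{Av}_n(312)$ with $\mathcal H\in\mathrm{VHC}(\pi)$. Let $\mathfrak R_0,\dots,\mathfrak R_\ell$ be the left-to-right maxima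 of the plot (points higher than every point to their left) listed right to left, and $\mathfrak R_{\ell+1}=(0,0)$. For $1\le i\le\ell$, $\gamma_i$ is the number of plot points with $x$-coordinate strictly between those of $\mathfrak R_i$ and $\mathfrak R_{i-1}$, and $\gamma_i'$ the number of plot points with height strictly between those of $\mathfrak R_{i+1}$ and $\mathfrak R_i$. Put $X_j=U$ if $\mathfrak R_{j-1}$ is a northeast endpoint of a hook of $\mathcal H$, else $X_j=E$. Then $\widehat{\Lambda\!\Lambda}_n(\mathcal H)=(X_1D^{\gamma_1}\cdots X_\ell D^{\gamma_\ell},\,X_1D^{\gamma_1'}\cdots X_\ell D^{\gamma_\ell'})$; this is a bijection onto $\operatorname{Int}(\mathcal M_{n-1}^C)$. *)

theory Defs
  imports Complex_Main "HOL-Library.Sublist" "HOL-Combinatorics.Multiset_Permutations"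
begin

section \<open>Permutations and patterns\<close>

text \<open>
  Permutations of \<open>{1..n}\<close> are written in one-line notation, i.e. they are the elements of
  \<^term>\<open>permutations_of_set {1..n}\<close>. Lists are indexed from 0, whereas positions in a
  permutation are numbered from 1; \<open>entry\<close> performs the shift.
\<close>

definition entry :: "nat list \<Rightarrow> nat \<Rightarrow> nat" where
  "entry p i = p ! (i - 1)"

definition contains_pattern :: "nat list \<Rightarrow> nat list \<Rightarrow> bool" where
  "contains_pattern p t \<longleftrightarrow>
     (\<exists>s. subseq s p \<and> length s = length t \<and>
        (\<forall>i<length t. \<forall>j<length t. s ! i < s ! j \<longleftrightarrow> t ! i < t ! j))"

definition Av :: "nat \<Rightarrow> nat list set \<Rightarrow> nat list set" where
  "Av n T = {p \<in> permutations_of_set {1..n}. \<forall>t\<in>T. \<not> contains_pattern p t}"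

definition point :: "nat list \<Rightarrow> nat \<Rightarrow> nat \<times> nat" where
  "point p i = (i, entry p i)"

definition plot :: "nat list \<Rightarrow> (nat \<times> nat) set" where
  "plot p = point p ` {1..length p}"

definition descents :: "nat list \<Rightarrow> nat set" where
  "descents p = {i \<in> {1..<length p}. entry p i > entry p (i + 1)}"


section \<open>Valid hook configurations\<close>

text \<open>A hook of \<open>p\<close> is given by the pair \<open>(i, j)\<close> of the positions of its two endpoints.\<close>

type_synonym hook = "nat \<times> nat"

definition is_hook :: "nat list \<Rightarrow> hook \<Rightarrow> bool" where
  "is_hook p h \<longleftrightarrow> fst h \<in> {1..length p} \<and> snd h \<in> {1..length p} \<and>
     fst h < snd h \<and> entry p (fst h) < entry p (snd h)"

definition sw :: "nat list \<Rightarrow> hook \<Rightarrow> nat \<times> nat" where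
  "sw p h = point p (fst h)"

definition ne :: "nat list \<Rightarrow> hook \<Rightarrow> nat \<times> nat" where
  "ne p h = point p (snd h)"

text \<open>The set of points of the plane covered by a hook: its vertical and its horizontal segment.\<close>

definition hook_region :: "nat list \<Rightarrow> hook \<Rightarrow> (real \<times> real) set" where
  "hook_region p h = (let i = fst h; j = snd h in
     {real i} \<times> {real (entry p i)..real (entry p j)} \<union>
     {real i..real j} \<times> {real (entry p j)})"

definition real_point :: "nat \<times> nat \<Rightarrow> real \<times> real" where
  "real_point q = (real (fst q), real (snd q))"

definition directly_above :: "real \<times> real \<Rightarrow> (real \<times> real) set \<Rightarrow> bool" where
  "directly_above q S \<longleftrightarrow> (\<exists>y < snd q. (fst q, y) \<in> S)"

definition hooks_compatible :: "nat list \<Rightarrow> hook \<Rightarrow> hook \<Rightarrow> bool" where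
  "hooks_compatible p h h' \<longleftrightarrow>
     (\<forall>q \<in> hook_region p h \<inter> hook_region p h'.
        q = real_point (ne p h) \<and> q = real_point (sw p h') \<or>
        q = real_point (sw p h) \<and> q = real_point (ne p h'))"

definition valid_hook_configuration :: "nat list \<Rightarrow> hook list \<Rightarrow> bool" where
  "valid_hook_configuration p H \<longleftrightarrow>
     (\<forall>h\<in>set H. is_hook p h) \<and>
     map (sw p) H = map (point p) (sorted_list_of_set (descents p)) \<and>
     (\<forall>h\<in>set H. \<forall>q\<in>plot p. \<not> directly_above (real_point q) (hook_region p h)) \<and>
     (\<forall>a<length H. \<forall>b<length H. a \<noteq> b \<longrightarrow> hooks_compatible p (H ! a) (H ! b))"

text \<open>
  The permutation is a component of the configuration, so that configurations of distinct
  permutations are distinct.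
\<close>

definition VHC :: "nat list set \<Rightarrow> (nat list \<times> hook list) set" where
  "VHC A = (\<Union>p\<in>A. {(p, H) | H. valid_hook_configuration p H})"


section \<open>Motzkin paths and intervals\<close>

datatype step = Up | Down | East

definition motzkin_paths :: "nat \<Rightarrow> step list set" where
  "motzkin_paths n = {w. length w = n \<and> count_list w Up = count_list w Down \<and>
     (\<forall>v. prefix v w \<longrightarrow> count_list v Down \<le> count_list v Up)}"

definition motzkin_number :: "nat \<Rightarrow> nat" where
  "motzkin_number n = card (motzkin_paths n)"

definition assemble :: "step list \<Rightarrow> nat list \<Rightarrow> step list" where
  "assemble X g = concat (map2 (\<lambda>x k. x # replicate k Down) X g)"

text \<open>
  In the decomposition \<open>X\<^sub>1 D\<^bsup>\<gamma>\<^sub>1\<^esup> \<dots> X\<^sub>m D\<^bsup>\<gamma>\<^sub>m\<^esup>\<close> of a path, the list \<open>X\<close> consists of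
  the letters other than \<open>D\<close>.
\<close>

definition non_downs :: "step list \<Rightarrow> step list" where
  "non_downs w = filter (\<lambda>x. x \<noteq> Down) w"

lemma non_downs_assemble:
  assumes "length X = length g" "Down \<notin> set X"
  shows "non_downs (assemble X g) = X"
  using assms by (induction X g rule: list_induct2) (auto simp: non_downs_def assemble_def)

definition cl :: "step list \<Rightarrow> nat set" where
  "cl w = {j \<in> {1..length (non_downs w)}. non_downs w ! (j - 1) = East}"

text \<open>
  Pitfall: this relation compares the numbers of \<open>U\<close>'s only, so it is reflexive and transitive
  on paths of a given length but not antisymmetric once \<open>E\<close> steps are present: it relates
  \<open>UDE\<close> and \<open>UED\<close> in both directions, even after fixing \<open>cl\<close>.
\<close>

definition le_S :: "step list \<Rightarrow> step list \<Rightarrow> bool" where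
  "le_S v w \<longleftrightarrow> (\<forall>i. count_list (take i v) Up \<le> count_list (take i w) Up)"

definition le_C :: "step list \<Rightarrow> step list \<Rightarrow> bool" where
  "le_C v w \<longleftrightarrow> cl v = cl w \<and> le_S v w"

definition intervals :: "'a set \<Rightarrow> ('a \<Rightarrow> 'a \<Rightarrow> bool) \<Rightarrow> ('a \<times> 'a) set" where
  "intervals P le = {(x, y). x \<in> P \<and> y \<in> P \<and> le x y}"

definition Int_motzkin_C :: "nat \<Rightarrow> (step list \<times> step list) set" where
  "Int_motzkin_C n = intervals (motzkin_paths n) le_C"

definition Int_motzkin_A :: "nat \<Rightarrow> (step list \<times> step list) set" where
  "Int_motzkin_A n = intervals (motzkin_paths n) (=)"


section \<open>The map to pairs of Motzkin paths\<close>

definition lr_max_positions :: "nat list \<Rightarrow> nat set" where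
  "lr_max_positions p = {i \<in> {1..length p}. \<forall>k\<in>{1..<i}. entry p k < entry p i}"

text \<open>
  The left-to-right maxima \<open>R\<^sub>0, \<dots>, R\<^sub>\<ell>\<close> from right to left, followed by
  \<open>R\<^bsub>\<ell>+1\<^esub> = (0, 0)\<close>. For nonempty \<open>p\<close> there are \<open>\<ell> + 1\<close> left-to-right maxima.
\<close>

definition lr_max :: "nat list \<Rightarrow> nat \<Rightarrow> nat \<times> nat" where
  "lr_max p i = (map (point p) (rev (sorted_list_of_set (lr_max_positions p))) @ [(0, 0)]) ! i"

definition ell :: "nat list \<Rightarrow> nat" where
  "ell p = card (lr_max_positions p) - 1"

definition gap_x :: "nat list \<Rightarrow> nat \<Rightarrow> nat" where
  "gap_x p i = card {q \<in> plot p. fst (lr_max p i) < fst q \<and> fst q < fst (lr_max p (i - 1))}"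

definition gap_y :: "nat list \<Rightarrow> nat \<Rightarrow> nat" where
  "gap_y p i = card {q \<in> plot p. snd (lr_max p (i + 1)) < snd q \<and> snd q < snd (lr_max p i)}"

definition letter :: "nat list \<Rightarrow> hook list \<Rightarrow> nat \<Rightarrow> step" where
  "letter p H j = (if lr_max p (j - 1) \<in> ne p ` set H then Up else East)"

definition LL :: "nat list \<times> hook list \<Rightarrow> step list \<times> step list" where
  "LL = (\<lambda>(p, H). let is = [1..<ell p + 1]; X = map (letter p H) is in
     (assemble X (map (gap_x p) is), assemble X (map (gap_y p) is)))"

end

theory Submission
  imports Defs
begin

text \<open>
  Hooks are intervals, and a valid hook configuration is a noncrossing matching of the descents
  with positions that dominate everything between them and their descent. Given the set of
  closers, such a matching is unique, and it exists iff a ballot condition holds; so a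
  configuration amounts to a permutation in the class with a ballot choice of closers.

  If 312 is avoided, every ascent top is a left-to-right maximum, hence a possible closer. In both
  classes that avoid 312 the permutation is determined by its arbitrary descent set, so reading the
  positions \<open>n, \<dots>, 2\<close> with \<open>D\<close> after a descent, \<open>U\<close> at closers and \<open>E\<close> elsewhere gives an
  arbitrary Motzkin path. A permutation avoiding 132 and 231 decreases to 1 and then increases;
  there the same reading works for the values \<open>n, \<dots>, 2\<close> instead of the positions. A permutation
  avoiding 231 and 312 is a sum of decreasing blocks, and both components of its image are the
  path read off the positions.
\<close>

section \<open>Permutations in one-line notation\<close>

text \<open>Existence and uniqueness of a matching rest on one greedy rule: the last opener takes
  the nearest closer to its right. For the classes avoiding 312, descents are replaced by their
  bottoms: \<open>d < c\<close> becomes \<open>d + 1 \<le> c\<close>, and no closer is a descent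
  bottom, so bottoms and closers are disjoint sets subject to the weak ballot inequality that
  prefixes of a Motzkin word express. The class avoiding 132 and 231 resists this reading: its
  descent sets are initial intervals, which do not determine the permutation, and all closers lie to
  the right of all openers, so positions constrain only the number of closers. There the ballot
  condition comes from the heights, because all hooks are nested and each of them has to go
  up.\<close>

lemma length_permutation:
  assumes "p \<in> permutations_of_set {1..n::nat}"
  shows "length p = n"
  using length_finite_permutations_of_set[OF assms] by simp

lemma bij_betw_entry:
  assumes p: "p \<in> permutations_of_set {1..n}"
  shows "bij_betw (entry p) {1..n} {1..n}"
proof -
  have l: "length p = n" and d: "distinct p" and s: "set p = {1..n}"
    using length_permutation[OF p] permutations_of_setD[OF p] by auto
  have "bij_betw ((!) p) {..<n} {1..n}"
    using bij_betw_nth[OF d, of "{..<n}"] l s by auto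
  moreover have "bij_betw (\<lambda>i. i - 1) {1..n} {..<n}"
    by (rule bij_betw_byWitness[where f' = Suc]) auto
  ultimately have "bij_betw ((!) p \<circ> (\<lambda>i. i - 1)) {1..n} {1..n}"
    by (rule bij_betw_trans[rotated])
  thus ?thesis
    by (simp add: entry_def[abs_def] comp_def)
qed

lemma entry_eq_iff:
  assumes "p \<in> permutations_of_set {1..n}" "i \<in> {1..n}" "j \<in> {1..n}"
  shows "entry p i = entry p j \<longleftrightarrow> i = j"
  using inj_on_eq_iff[OF bij_betw_imp_inj_on[OF bij_betw_entry[OF assms(1)]] assms(2,3)] .

lemma entry_in:
  assumes "p \<in> permutations_of_set {1..n}" "i \<in> {1..n}"
  shows "entry p i \<in> {1..n}"
  by (rule bij_betwE[OF bij_betw_entry[OF assms(1)], rule_format, OF assms(2)])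

lemma nth_eq_entry: "p ! i = entry p (Suc i)"
  by (simp add: entry_def)

text \<open>The entries that do not exceed \<open>entry p i\<close> are exactly the numbers up to
  it. A value is therefore its rank, and can be found from comparisons alone.\<close>

lemma entry_eq_card:
  assumes p: "p \<in> permutations_of_set {1..n}" and i: "i \<in> {1..n}"
  shows "entry p i = card {j \<in> {1..n}. entry p j \<le> entry p i}"
proof -
  have "bij_betw (entry p) {j \<in> {1..n}. entry p j \<le> entry p i} {1..entry p i}"
  proof (rule bij_betw_subset[OF bij_betw_entry[OF p]])
    have "{1..entry p i} \<subseteq> entry p ` {1..n}"
      using bij_betw_entry[OF p] entry_in[OF p i] by (auto simp: bij_betw_def)
    moreover have "\<forall>j\<in>{1..n}. entry p j \<in> {1..n}"
      using entry_in[OF p] by blast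
    ultimately show "entry p ` {j \<in> {1..n}. entry p j \<le> entry p i} = {1..entry p i}"
      by fastforce
  qed auto
  thus ?thesis
    using bij_betw_same_card by fastforce
qed

text \<open>A permutation is determined by its inversions: they fix all comparisons because entries
  are distinct, and comparisons fix the ranks.\<close>

lemma permutation_eqI:
  assumes p: "p \<in> permutations_of_set {1..n}" and q: "q \<in> permutations_of_set {1..n}"
    and less: "\<And>i j. 1 \<le> i \<Longrightarrow> i < j \<Longrightarrow> j \<le> n \<Longrightarrow> entry p j < entry p i \<longleftrightarrow> entry q j < entry q i"
  shows "p = q"
proof (rule nth_equalityI)
  show "length p = length q"
    using length_permutation[OF p] length_permutation[OF q] by simp
  have le: "entry p j \<le> entry p i \<longleftrightarrow> entry q j \<le> entry q i" if "i \<in> {1..n}" "j \<in> {1..n}" for i j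
    using less[of i j] less[of j i] that entry_eq_iff[OF p that] entry_eq_iff[OF q that]
    by (cases i j rule: linorder_cases) auto
  fix i assume "i < length p"
  hence i: "Suc i \<in> {1..n}"
    using length_permutation[OF p] by simp
  have "{j \<in> {1..n}. entry p j \<le> entry p (Suc i)} = {j \<in> {1..n}. entry q j \<le> entry q (Suc i)}"
    using le[OF i] by auto
  thus "p ! i = q ! i"
    using entry_eq_card[OF p i] entry_eq_card[OF q i] by (simp add: nth_eq_entry)
qed

text \<open>Each position receives its rank under \<open>R\<close> as entry. This is the source of
  permutations with a prescribed descent set: it suffices to describe an order on positions.\<close>

lemma ex_permutation_of_order:
  assumes irrefl: "\<And>i. \<not> R i i"
    and trans: "\<And>i j k. R i j \<Longrightarrow> R j k \<Longrightarrow> R i k"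
    and total: "\<And>i j. i \<in> {1..n} \<Longrightarrow> j \<in> {1..n} \<Longrightarrow> i \<noteq> j \<Longrightarrow> R i j \<or> R j i"
  obtains p where "p \<in> permutations_of_set {1..n::nat}"
    "\<And>i j. i \<in> {1..n} \<Longrightarrow> j \<in> {1..n} \<Longrightarrow> entry p i < entry p j \<longleftrightarrow> R i j"
proof -
  define r where "r i = Suc (card {j \<in> {1..n}. R j i})" for i
  define p where "p = map r [1..<Suc n]"
  have entry: "entry p i = r i" if "i \<in> {1..n}" for i
  proof -
    have "i - 1 < length [1..<Suc n]" "[1..<Suc n] ! (i - 1) = i"
      using that by (auto simp: nth_upt simp del: upt_Suc)
    thus ?thesis
      by (simp add: p_def entry_def del: upt_Suc)
  qed
  have mono: "r i < r j" if "R i j" "i \<in> {1..n}" "j \<in> {1..n}" for i j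
  proof -
    have "{k \<in> {1..n}. R k i} \<subseteq> {k \<in> {1..n}. R k j}"
      using trans[OF _ that(1)] by auto
    moreover have "i \<in> {k \<in> {1..n}. R k j} - {k \<in> {1..n}. R k i}"
      using that irrefl by simp
    ultimately have "{k \<in> {1..n}. R k i} \<subset> {k \<in> {1..n}. R k j}"
      by blast
    thus ?thesis
      by (simp add: r_def psubset_card_mono)
  qed
  have iff: "r i < r j \<longleftrightarrow> R i j" if "i \<in> {1..n}" "j \<in> {1..n}" for i j
    using mono[of i j] mono[of j i] total[OF that] that by fastforce
  have inj: "inj_on r {1..n}"
    by (rule inj_onI) (metis mono total less_irrefl)
  have "r i \<le> n" if "i \<in> {1..n}" for i
  proof -
    have "i \<in> {1..n} - {k \<in> {1..n}. R k i}"
      using irrefl that by simp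
    hence "{k \<in> {1..n}. R k i} \<subset> {1..n}"
      by blast
    thus ?thesis
      using psubset_card_mono[of "{1..n}" "{k \<in> {1..n}. R k i}"] by (simp add: r_def)
  qed
  hence "r ` {1..n} \<subseteq> {1..n}"
    by (auto simp: r_def)
  hence "r ` {1..n} = {1..n}"
    using inj by (simp add: endo_inj_surj)
  hence "p \<in> permutations_of_set {1..n}"
    using inj by (intro permutations_of_setI)
      (simp_all add: p_def distinct_map atLeastLessThanSuc_atLeastAtMost del: upt_Suc)
  thus ?thesis
    using iff entry by (intro that) auto
qed

section \<open>Patterns of length three in terms of positions\<close>

lemma subseq_Cons_iff_nth:
  "subseq (x # xs) p \<longleftrightarrow> (\<exists>i<length p. p ! i = x \<and> subseq xs (drop (Suc i) p))"
proof
  assume "subseq (x # xs) p"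
  then obtain us v vs where "p = us @ v # vs" "x = v" "subseq xs vs"
    by (auto dest: list_emb_ConsD)
  thus "\<exists>i<length p. p ! i = x \<and> subseq xs (drop (Suc i) p)"
    by (intro exI[of _ "length us"]) auto
next
  assume "\<exists>i<length p. p ! i = x \<and> subseq xs (drop (Suc i) p)"
  then obtain i where "i < length p" "p ! i = x" "subseq xs (drop (Suc i) p)"
    by blast
  thus "subseq (x # xs) p"
    by (metis id_take_nth_drop list_emb_append2 subseq_Cons2)
qed

lemma subseq_length_3_iff:
  "subseq [x, y, z] p \<longleftrightarrow>
     (\<exists>i j k. 1 \<le> i \<and> i < j \<and> j < k \<and> k \<le> length p \<and> x = entry p i \<and> y = entry p j \<and> z = entry p k)"
proof
  assume "subseq [x, y, z] p"
  then obtain i j k where i: "i < length p" "p ! i = x"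
    and j: "j < length (drop (Suc i) p)" "drop (Suc i) p ! j = y"
    and k: "k < length (drop (Suc j) (drop (Suc i) p))" "drop (Suc j) (drop (Suc i) p) ! k = z"
    unfolding subseq_Cons_iff_nth by blast
  show "\<exists>i j k. 1 \<le> i \<and> i < j \<and> j < k \<and> k \<le> length p \<and> x = entry p i \<and> y = entry p j \<and> z = entry p k"
  proof (intro exI conjI)
    show "x = entry p (Suc i)" "y = entry p (Suc (Suc (i + j)))" "z = entry p (Suc (Suc (Suc (i + j + k))))"
      using i j k by (simp_all add: entry_def add_ac)
  qed (use k in simp_all)
next
  assume "\<exists>i j k. 1 \<le> i \<and> i < j \<and> j < k \<and> k \<le> length p \<and> x = entry p i \<and> y = entry p j \<and> z = entry p k"
  then obtain i j k where ijk: "1 \<le> i" "i < j" "j < k" "k \<le> length p"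
    and xyz: "x = entry p i" "y = entry p j" "z = entry p k"
    by blast
  have "subseq [z] (drop j p)"
    unfolding subseq_Cons_iff_nth using ijk xyz by (intro exI[of _ "k - j - 1"]) (simp add: entry_def)
  hence "subseq [y, z] (drop i p)"
    unfolding subseq_Cons_iff_nth[of y] using ijk xyz by (intro exI[of _ "j - i - 1"]) (simp add: entry_def)
  thus "subseq [x, y, z] p"
    unfolding subseq_Cons_iff_nth[of x] using ijk xyz by (intro exI[of _ "i - 1"]) (simp add: entry_def)
qed

lemma contains_pattern_length_3:
  "contains_pattern p [a, b, c] \<longleftrightarrow>
     (\<exists>i j k. 1 \<le> i \<and> i < j \<and> j < k \<and> k \<le> length p \<and>
        (entry p i < entry p j \<longleftrightarrow> a < b) \<and> (entry p j < entry p i \<longleftrightarrow> b < a) \<and>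
        (entry p i < entry p k \<longleftrightarrow> a < c) \<and> (entry p k < entry p i \<longleftrightarrow> c < a) \<and>
        (entry p j < entry p k \<longleftrightarrow> b < c) \<and> (entry p k < entry p j \<longleftrightarrow> c < b))"
    (is "_ = (\<exists>i j k. _ \<and> _ \<and> _ \<and> _ \<and> ?Q (entry p i) (entry p j) (entry p k))")
proof -
  have "contains_pattern p [a, b, c] \<longleftrightarrow> (\<exists>x y z. subseq [x, y, z] p \<and> ?Q x y z)"
  proof
    assume "contains_pattern p [a, b, c]"
    then obtain s where s: "subseq s p" "length s = length [a, b, c]"
      and less: "\<forall>i<length [a, b, c]. \<forall>j<length [a, b, c]. s ! i < s ! j \<longleftrightarrow> [a, b, c] ! i < [a, b, c] ! j"
      unfolding contains_pattern_def by blast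
    obtain x y z where xyz: "s = [x, y, z]"
      using s(2) by (auto simp: length_Suc_conv)
    have "s ! i < s ! j \<longleftrightarrow> [a, b, c] ! i < [a, b, c] ! j" if "i < 3" "j < 3" for i j
      using less that by simp
    from this[of 0 1] this[of 1 0] this[of 0 2] this[of 2 0] this[of 1 2] this[of 2 1]
    have "?Q x y z"
      by (simp add: xyz)
    thus "\<exists>x y z. subseq [x, y, z] p \<and> ?Q x y z"
      using s(1) xyz by blast
  next
    assume "\<exists>x y z. subseq [x, y, z] p \<and> ?Q x y z"
    then obtain x y z where "subseq [x, y, z] p" "?Q x y z"
      by blast
    thus "contains_pattern p [a, b, c]"
      unfolding contains_pattern_def by (intro exI[of _ "[x, y, z]"]) (auto simp: less_Suc_eq)
  qed
  moreover have "(\<exists>x y z. subseq [x, y, z] p \<and> Q x y z) \<longleftrightarrow>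
      (\<exists>i j k. 1 \<le> i \<and> i < j \<and> j < k \<and> k \<le> length p \<and> Q (entry p i) (entry p j) (entry p k))"
    for Q :: "nat \<Rightarrow> nat \<Rightarrow> nat \<Rightarrow> bool"
    unfolding subseq_length_3_iff by blast
  ultimately show ?thesis
    by simp
qed

text \<open>Of the six comparisons, two form a chain that implies the others. The curried form with
  a negated conclusion lets avoidance exclude one of the two possible orders of distinct
  entries.\<close>

lemma not_contains_132:
  "\<not> contains_pattern p [1,3,2] \<longleftrightarrow>
     (\<forall>i j k. 1 \<le> i \<longrightarrow> i < j \<longrightarrow> j < k \<longrightarrow> k \<le> length p \<longrightarrow> entry p i < entry p k \<longrightarrow> \<not> entry p k < entry p j)"
proof -
  have eq: "(x < y \<longleftrightarrow> (1::nat) < 3) \<and> (y < x \<longleftrightarrow> (3::nat) < 1) \<and> (x < z \<longleftrightarrow> (1::nat) < 2) \<and>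
    (z < x \<longleftrightarrow> (2::nat) < 1) \<and> (y < z \<longleftrightarrow> (3::nat) < 2) \<and> (z < y \<longleftrightarrow> (2::nat) < 3) \<longleftrightarrow> x < z \<and> z < y"
    for x y z :: nat
    by auto
  show ?thesis
    unfolding contains_pattern_length_3 eq by blast
qed

lemma not_contains_231:
  "\<not> contains_pattern p [2,3,1] \<longleftrightarrow>
     (\<forall>i j k. 1 \<le> i \<longrightarrow> i < j \<longrightarrow> j < k \<longrightarrow> k \<le> length p \<longrightarrow> entry p k < entry p i \<longrightarrow> \<not> entry p i < entry p j)"
proof -
  have eq: "(x < y \<longleftrightarrow> (2::nat) < 3) \<and> (y < x \<longleftrightarrow> (3::nat) < 2) \<and> (x < z \<longleftrightarrow> (2::nat) < 1) \<and>
    (z < x \<longleftrightarrow> (1::nat) < 2) \<and> (y < z \<longleftrightarrow> (3::nat) < 1) \<and> (z < y \<longleftrightarrow> (1::nat) < 3) \<longleftrightarrow> z < x \<and> x < y"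
    for x y z :: nat
    by auto
  show ?thesis
    unfolding contains_pattern_length_3 eq by blast
qed

lemma not_contains_312:
  "\<not> contains_pattern p [3,1,2] \<longleftrightarrow>
     (\<forall>i j k. 1 \<le> i \<longrightarrow> i < j \<longrightarrow> j < k \<longrightarrow> k \<le> length p \<longrightarrow> entry p j < entry p k \<longrightarrow> \<not> entry p k < entry p i)"
proof -
  have eq: "(x < y \<longleftrightarrow> (3::nat) < 1) \<and> (y < x \<longleftrightarrow> (1::nat) < 3) \<and> (x < z \<longleftrightarrow> (3::nat) < 2) \<and>
    (z < x \<longleftrightarrow> (2::nat) < 3) \<and> (y < z \<longleftrightarrow> (1::nat) < 2) \<and> (z < y \<longleftrightarrow> (2::nat) < 1) \<longleftrightarrow> y < z \<and> z < x"
    for x y z :: nat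
    by auto
  show ?thesis
    unfolding contains_pattern_length_3 eq by blast
qed

section \<open>Noncrossing matchings\<close>

text \<open>The weak inequality \<open>snd h \<le> fst h'\<close> encodes the permitted contact of a
  northeast with a southwest endpoint; the strict \<open>snd h' < snd h\<close> forbids a common
  northeast endpoint. Openers are compared weakly in the premise so that their distinctness is part
  of the notion.\<close>

definition noncrossing :: "hook set \<Rightarrow> bool" where
  "noncrossing S \<longleftrightarrow> (\<forall>h\<in>S. fst h < snd h) \<and>
     (\<forall>h\<in>S. \<forall>h'\<in>S. h \<noteq> h' \<longrightarrow> fst h \<le> fst h' \<longrightarrow>
        fst h < fst h' \<and> (snd h \<le> fst h' \<or> snd h' < snd h))"

lemma noncrossing_less: "noncrossing S \<Longrightarrow> h \<in> S \<Longrightarrow> fst h < snd h"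
  unfolding noncrossing_def by blast

lemma noncrossing_cases:
  assumes "noncrossing S" "h \<in> S" "h' \<in> S" "fst h < fst h'"
  shows "snd h \<le> fst h' \<or> snd h' < snd h"
  using assms unfolding noncrossing_def by (metis less_imp_le less_irrefl)

lemma noncrossing_inj_fst: "noncrossing S \<Longrightarrow> inj_on fst S"
  unfolding noncrossing_def by (rule inj_onI) (metis less_irrefl order_refl)

lemma noncrossing_inj_snd:
  assumes S: "noncrossing S"
  shows "inj_on snd S"
proof (rule inj_onI)
  fix h h' assume h: "h \<in> S" "h' \<in> S" "snd h = snd h'"
  have "\<not> fst h < fst h'" "\<not> fst h' < fst h"
    using noncrossing_cases[OF S] noncrossing_less[OF S] h by fastforce+
  thus "h = h'"
    using noncrossing_inj_fst[OF S] h by (auto simp: inj_on_def)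
qed

lemma noncrossing_subset: "noncrossing S \<Longrightarrow> T \<subseteq> S \<Longrightarrow> noncrossing T"
  unfolding noncrossing_def by blast

text \<open>A closer strictly between \<open>b\<close> and \<open>c\<close> would belong to an
  interval opened before \<open>b\<close>, which would then cross \<open>(b, c)\<close>. So the last
  opener takes the nearest available closer.\<close>

lemma noncrossing_last_opener:
  assumes S: "noncrossing S" and b: "(b, c) \<in> S" and max: "\<forall>a\<in>fst ` S. a \<le> b"
    and c': "c' \<in> snd ` S" "b < c'"
  shows "c \<le> c'"
proof -
  obtain a where a: "(a, c') \<in> S"
    using c' by force
  show ?thesis
  proof (cases "a = b")
    case True
    thus ?thesis
      using inj_onD[OF noncrossing_inj_fst[OF S] _ a b] by simp
  next
    case False
    hence "a < b"
      using max a by force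
    thus ?thesis
      using noncrossing_cases[OF S a b] c' by auto
  qed
qed

text \<open>The last opener has the same closer in both matchings, by
  \<open>noncrossing_last_opener\<close> used in both directions; this pair is removed and the rest
  follows by induction.\<close>

lemma noncrossing_unique:
  assumes "finite D"
  shows "\<lbrakk>noncrossing S; noncrossing T; fst ` S = D; fst ` T = D; snd ` S = snd ` T\<rbrakk> \<Longrightarrow> S = T"
  using assms
proof (induction D arbitrary: S T rule: finite_linorder_max_induct)
  case empty
  thus ?case by simp
next
  case (insert b D)
  have bD: "b \<notin> D" and max: "\<forall>a\<in>insert b D. a \<le> b"
    using insert.hyps by auto
  obtain c where c: "(b, c) \<in> S"
    using insert.prems(3) by (metis imageE insertI1 prod.collapse)
  obtain c' where c': "(b, c') \<in> T"
    using insert.prems(4) by (metis imageE insertI1 prod.collapse)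
  have snd: "c \<in> snd ` S" "c' \<in> snd ` T"
    using c c' by force+
  have "c \<le> c'"
  proof (rule noncrossing_last_opener[OF insert.prems(1) c])
    show "\<forall>a\<in>fst ` S. a \<le> b" "c' \<in> snd ` S" "b < c'"
      using max insert.prems(3,5) snd noncrossing_less[OF insert.prems(2) c'] by simp_all
  qed
  moreover have "c' \<le> c"
  proof (rule noncrossing_last_opener[OF insert.prems(2) c'])
    show "\<forall>a\<in>fst ` T. a \<le> b" "c \<in> snd ` T" "b < c"
      using max insert.prems(4,5) snd noncrossing_less[OF insert.prems(1) c] by simp_all
  qed
  ultimately have [simp]: "c' = c" by simp
  have image: "fst ` (X - {(b, c)}) = D" "snd ` (X - {(b, c)}) = snd ` X - {c}"
    if "noncrossing X" "(b, c) \<in> X" "fst ` X = insert b D" for X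
  proof -
    show "fst ` (X - {(b, c)}) = D"
      using inj_on_image_set_diff[OF noncrossing_inj_fst[OF that(1)], of X "{(b, c)}"] that bD by auto
    show "snd ` (X - {(b, c)}) = snd ` X - {c}"
      using inj_on_image_set_diff[OF noncrossing_inj_snd[OF that(1)], of X "{(b, c)}"] that by auto
  qed
  have "S - {(b, c)} = T - {(b, c)}"
    using insert.prems c c' image[of S] image[of T]
    by (intro insert.IH) (auto intro: noncrossing_subset)
  thus ?case
    using c c' by auto
qed

text \<open>Greedy construction from the last opener \<open>b\<close>, which takes the least closer
  beyond it. The ballot condition at \<open>x = b\<close> provides that closer. After removal both
  sides drop by one for \<open>x \<le> b\<close>, and for \<open>x > b\<close> no opener is left to
  count.\<close>

lemma noncrossing_exists:
  assumes "finite D"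
  shows "\<lbrakk>finite C; card C = card D; \<forall>x. card {d\<in>D. x \<le> d} \<le> card {c\<in>C. x < c}\<rbrakk> \<Longrightarrow>
     \<exists>S. noncrossing S \<and> fst ` S = D \<and> snd ` S = C"
  using assms
proof (induction D arbitrary: C rule: finite_linorder_max_induct)
  case empty
  thus ?case
    by (intro exI[of _ "{}"]) (auto simp: noncrossing_def)
next
  case (insert b D)
  have bD: "b \<notin> D"
    using insert.hyps by auto
  define c where "c = Min {c\<in>C. b < c}"
  have "{d\<in>insert b D. b \<le> d} = {b}"
    using insert.hyps by auto
  hence "card {c\<in>C. b < c} \<noteq> 0"
    using insert.prems(3)[rule_format, of b] by auto
  hence ne: "{c\<in>C. b < c} \<noteq> {}"
    by force
  have c: "c \<in> C" "b < c"
    using Min_in[OF _ ne] insert.prems(1) by (auto simp: c_def)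
  have least: "c \<le> c'" if "c' \<in> C" "b < c'" for c'
    using that insert.prems(1) by (auto simp: c_def)
  have "\<exists>S. noncrossing S \<and> fst ` S = D \<and> snd ` S = C - {c}"
  proof (rule insert.IH; (intro allI)?)
    show "finite (C - {c})"
      using insert.prems by simp
    show "card (C - {c}) = card D"
      using insert.prems c bD insert.hyps by simp
    fix x
    show "card {d \<in> D. x \<le> d} \<le> card {c' \<in> C - {c}. x < c'}"
    proof (cases "x \<le> b")
      case True
      have "{d \<in> insert b D. x \<le> d} = insert b {d \<in> D. x \<le> d}"
        using True by auto
      hence "card {d \<in> insert b D. x \<le> d} = Suc (card {d \<in> D. x \<le> d})"
        using bD insert.hyps by simp
      moreover have "{c' \<in> C - {c}. x < c'} = {c' \<in> C. x < c'} - {c}"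
        by auto
      hence "card {c' \<in> C - {c}. x < c'} = card {c' \<in> C. x < c'} - 1"
        using True c insert.prems(1) by simp
      ultimately show ?thesis
        using insert.prems(3)[rule_format, of x] by linarith
    next
      case False
      hence "{d \<in> D. x \<le> d} = {}"
        using insert.hyps by force
      thus ?thesis
        by (metis card.empty zero_le)
    qed
  qed
  then obtain S where S: "noncrossing S" "fst ` S = D" "snd ` S = C - {c}"
    by blast
  \<comment> \<open>By minimality of \<open>c\<close> no other closer lies between \<open>b\<close>
    and \<open>c\<close>, so each earlier interval encloses \<open>(b, c)\<close> or ends by
    \<open>b\<close>.\<close>
  have lt: "fst h < b" "c < snd h \<or> snd h \<le> b" if "h \<in> S" for h
  proof -
    show "fst h < b"
      using that S(2) insert.hyps by auto
    have "snd h \<in> C - {c}"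
      using that S(3) by auto
    thus "c < snd h \<or> snd h \<le> b"
      using least by force
  qed
  have "noncrossing (insert (b, c) S)"
    unfolding noncrossing_def
  proof (intro conjI ballI impI)
    fix h assume "h \<in> insert (b, c) S"
    thus "fst h < snd h"
      using c S noncrossing_less by auto
  next
    fix h h' assume h: "h \<in> insert (b, c) S" "h' \<in> insert (b, c) S" "h \<noteq> h'" "fst h \<le> fst h'"
    consider "h \<in> S" "h' \<in> S" | "h \<in> S" "h' = (b, c)" | "h = (b, c)" "h' \<in> S"
      using h by auto
    thus "fst h < fst h'"
      using h lt(1)[of h] lt(1)[of h'] S(1) unfolding noncrossing_def by cases auto
    from h show "snd h \<le> fst h' \<or> snd h' < snd h"
      using lt[of h] lt[of h'] S(1) unfolding noncrossing_def by (auto dest: leD)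
  qed
  thus ?case
    using S c by (intro exI[of _ "insert (b, c) S"]) auto
qed

text \<open>A configuration is a list ordered by descents, a matching is a set. Distinct openers
  make the passage between them lossless; this lemma and the next give the two directions.\<close>

lemma list_eqI_map_fst_set:
  assumes "map fst G = map fst H" "distinct (map fst G)" "set G = set H"
  shows "G = H"
proof (rule nth_equalityI)
  show len: "length G = length H"
    using assms(1) by (metis length_map)
  fix i assume i: "i < length G"
  then obtain j where j: "j < length H" "G ! i = H ! j"
    using assms(3) by (metis in_set_conv_nth nth_mem)
  have "map fst G ! i = map fst G ! j"
    using i j len assms(1) by (metis nth_map)
  hence "i = j"
    using assms(2) i j len by (metis length_map nth_eq_iff_index_eq)
  thus "G ! i = H ! i"
    using j by simp
qed

lemma ex_list_map_fst:
  assumes "finite S" "inj_on fst S"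
  obtains H where "set H = S" "map fst H = sorted_list_of_set (fst ` S)"
proof
  show "set (map (the_inv_into S fst) (sorted_list_of_set (fst ` S))) = S"
    using assms the_inv_into_onto[of fst S] by simp
  show "map fst (map (the_inv_into S fst) (sorted_list_of_set (fst ` S))) = sorted_list_of_set (fst ` S)"
    using assms f_the_inv_into_f[of fst S] by (auto intro!: map_idI)
qed

section \<open>Valid hook configurations as noncrossing matchings\<close>

text \<open>Including the left endpoint makes one condition cover both that the hook goes up and
  that no point lies above it.\<close>

definition dominating :: "nat list \<Rightarrow> hook \<Rightarrow> bool" where
  "dominating p h \<longleftrightarrow> (\<forall>k\<in>{fst h..<snd h}. entry p k < entry p (snd h))"

text \<open>A point strictly between the endpoints lies over the horizontal segment unless it is
  lower than the right endpoint; equal heights are excluded by injectivity. The two endpoints lie on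
  the hook without being above any part of it.\<close>

lemma is_hook_directly_above_iff:
  assumes inj: "inj_on (entry p) {1..length p}"
  shows "is_hook p h \<and> (\<forall>q\<in>plot p. \<not> directly_above (real_point q) (hook_region p h)) \<longleftrightarrow>
     1 \<le> fst h \<and> fst h < snd h \<and> snd h \<le> length p \<and> dominating p h"
    (is "?L \<longleftrightarrow> ?R")
proof
  assume L: ?L
  obtain i j where h: "h = (i, j)" by force
  have ij: "1 \<le> i" "i < j" "j \<le> length p" "entry p i < entry p j"
    using L by (auto simp: is_hook_def h)
  have "entry p k < entry p j" if k: "i \<le> k" "k < j" for k
  proof (rule ccontr)
    assume "\<not> entry p k < entry p j"
    moreover have "entry p k \<noteq> entry p j"
      using inj_onD[OF inj, of k j] k ij by auto
    ultimately have "entry p j < entry p k" by simp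
    hence "directly_above (real_point (point p k)) (hook_region p h)"
      using k unfolding directly_above_def hook_region_def
      by (intro exI[of _ "real (entry p j)"]) (auto simp: real_point_def point_def h Let_def)
    thus False
      using L k ij by (auto simp: plot_def)
  qed
  thus ?R
    using ij by (auto simp: h dominating_def)
next
  assume R: ?R
  obtain i j where h: "h = (i, j)" by force
  have dom: "entry p k < entry p j" if "i \<le> k" "k < j" for k
    using R that by (auto simp: h dominating_def)
  have ij: "1 \<le> i" "i < j" "j \<le> length p"
    using R by (auto simp: h)
  have "\<not> directly_above (real_point (point p k)) (hook_region p h)" for k
  proof
    assume "directly_above (real_point (point p k)) (hook_region p h)"
    then obtain y where y: "y < real (entry p k)" "(real k, y) \<in> hook_region p h"
      by (auto simp: directly_above_def real_point_def point_def)
    then consider "k = i" "real (entry p i) \<le> y" | "i \<le> k" "k \<le> j" "y = real (entry p j)"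
      by (auto simp: hook_region_def h Let_def)
    thus False
    proof cases
      case 2
      thus False
        using y dom[of k] by (cases "k = j") auto
    qed (use y in auto)
  qed
  thus ?L
    using ij dom[of i] by (auto simp: is_hook_def h plot_def)
qed

lemma hooks_compatible_iff:
  assumes ij: "i < j" "i' < j'" "i < i'"
    and dom: "dominating p (i, j)" "dominating p (i', j')"
  shows "hooks_compatible p (i, j) (i', j') \<longleftrightarrow> j \<le> i' \<or> j' < j"
proof
  assume comp: "hooks_compatible p (i, j) (i', j')"
  show "j \<le> i' \<or> j' < j"
  proof (rule ccontr)
    assume "\<not> (j \<le> i' \<or> j' < j)"
    hence *: "i' < j" "j \<le> j'" by auto
    have "entry p i' < entry p j"
      using dom(1) * ij by (auto simp: dominating_def)
    moreover have "entry p j \<le> entry p j'"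
      using dom(2) * ij by (cases "j = j'") (auto simp: dominating_def less_imp_le)
    \<comment> \<open>The vertical segment of the later hook starts below height
      \<open>entry p j\<close> and reaches at least that height, so it meets the horizontal segment
      of the earlier hook here, away from the endpoints that may touch.\<close>
    ultimately have "(real i', real (entry p j)) \<in> hook_region p (i, j) \<inter> hook_region p (i', j')"
      using * ij by (auto simp: hook_region_def Let_def)
    hence "(real i', real (entry p j)) = real_point (ne p (i, j)) \<or>
      (real i', real (entry p j)) = real_point (sw p (i, j))"
      using comp unfolding hooks_compatible_def by blast
    thus False
      using * ij by (auto simp: real_point_def ne_def sw_def point_def)
  qed
next
  assume *: "j \<le> i' \<or> j' < j"
  show "hooks_compatible p (i, j) (i', j')"
    unfolding hooks_compatible_def
  proof
    fix q assume "q \<in> hook_region p (i, j) \<inter> hook_region p (i', j')"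
    moreover obtain x y where q: "q = (x, y)" by force
    ultimately have h: "(x, y) \<in> hook_region p (i, j)" "(x, y) \<in> hook_region p (i', j')"
      by auto
    have x': "real i' \<le> x" "x \<le> real j'" and y': "y \<le> real (entry p j')"
      using h(2) ij(2) dom(2) by (auto simp: hook_region_def Let_def)
    \<comment> \<open>The later hook lies strictly to the right of column \<open>i\<close>, so only
      the horizontal segment of the earlier one can be met.\<close>
    have y: "y = real (entry p j)" and x: "x \<le> real j"
      using h(1) x' ij by (auto simp: hook_region_def Let_def)
    have "\<not> j' < j"
    proof
      assume "j' < j"
      hence "entry p j' < entry p j"
        using dom(1) ij by (simp add: dominating_def)
      thus False
        using y y' by simp
    qed
    hence "x = real j" "i' = j"
      using * x x' by auto
    thus "q = real_point (ne p (i, j)) \<and> q = real_point (sw p (i', j')) \<or>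
      q = real_point (sw p (i, j)) \<and> q = real_point (ne p (i', j'))"
      using y by (auto simp: q real_point_def ne_def sw_def point_def)
  qed
qed

lemma hooks_compatible_sym: "hooks_compatible p h h' \<Longrightarrow> hooks_compatible p h' h"
  unfolding hooks_compatible_def by blast

lemma finite_descents: "finite (descents p)"
  unfolding descents_def by simp

lemma map_sw_eq_iff: "map (sw p) H = map (point p) xs \<longleftrightarrow> map fst H = xs"
proof -
  have "map (sw p) H = map (point p) (map fst H)"
    by (simp add: sw_def)
  moreover have "inj (point p)"
    by (auto simp: inj_def point_def)
  ultimately show ?thesis
    by (simp only: inj_map_eq_map)
qed

text \<open>This removes the plane geometry: pairwise compatibility becomes the noncrossing
  condition on positions, and the conditions on single hooks become domination.\<close>

lemma valid_hook_configuration_iff: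
  assumes inj: "inj_on (entry p) {1..length p}"
  shows "valid_hook_configuration p H \<longleftrightarrow>
     map fst H = sorted_list_of_set (descents p) \<and> noncrossing (set H) \<and>
     (\<forall>h\<in>set H. snd h \<le> length p \<and> dominating p h)"
proof (cases "map fst H = sorted_list_of_set (descents p)")
  case False
  thus ?thesis
    by (simp add: valid_hook_configuration_def map_sw_eq_iff)
next
  case True
  hence fst: "fst ` set H = descents p" and "distinct (map fst H)"
    by (simp_all add: finite_descents flip: set_map)
  hence distinct: "distinct H" and inj_fst: "inj_on fst (set H)"
    by (auto simp: distinct_map)
  have ge1: "1 \<le> fst h" if "h \<in> set H" for h
    using that fst by (auto simp: descents_def)
  define P where "P \<longleftrightarrow> (\<forall>h\<in>set H. fst h < snd h \<and> snd h \<le> length p \<and> dominating p h)"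
  \<comment> \<open>Distinct openers make the list distinct, so different indices amount to
    different hooks. Symmetry then leaves only pairs ordered by their openers.\<close>
  have "(\<forall>a<length H. \<forall>b<length H. a \<noteq> b \<longrightarrow> hooks_compatible p (H ! a) (H ! b)) \<longleftrightarrow>
    (\<forall>h\<in>set H. \<forall>h'\<in>set H. h \<noteq> h' \<longrightarrow> hooks_compatible p h h')"
    unfolding all_set_conv_all_nth using distinct by (auto simp: nth_eq_iff_index_eq)
  moreover have "(\<forall>h\<in>set H. is_hook p h) \<and>
      (\<forall>h\<in>set H. \<forall>q\<in>plot p. \<not> directly_above (real_point q) (hook_region p h)) \<longleftrightarrow> P"
    unfolding P_def ball_conj_distrib[symmetric] is_hook_directly_above_iff[OF inj] using ge1 by blast
  ultimately have "valid_hook_configuration p H \<longleftrightarrow>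
    P \<and> (\<forall>h\<in>set H. \<forall>h'\<in>set H. h \<noteq> h' \<longrightarrow> hooks_compatible p h h')"
    unfolding valid_hook_configuration_def map_sw_eq_iff using True by argo
  also have "\<dots> \<longleftrightarrow> P \<and> (\<forall>h\<in>set H. \<forall>h'\<in>set H. fst h < fst h' \<longrightarrow> hooks_compatible p h h')"
  proof -
    have "fst h < fst h' \<or> fst h' < fst h \<longleftrightarrow> h \<noteq> h'" if "h \<in> set H" "h' \<in> set H" for h h'
      using inj_onD[OF inj_fst _ that] by force
    thus ?thesis
      using hooks_compatible_sym by blast
  qed
  also have "\<dots> \<longleftrightarrow> P \<and> (\<forall>h\<in>set H. \<forall>h'\<in>set H. fst h < fst h' \<longrightarrow> snd h \<le> fst h' \<or> snd h' < snd h)"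
  proof -
    have "hooks_compatible p h h' \<longleftrightarrow> snd h \<le> fst h' \<or> snd h' < snd h"
      if P "h \<in> set H" "h' \<in> set H" "fst h < fst h'" for h h'
      using hooks_compatible_iff[of "fst h" "snd h" "fst h'" "snd h'" p] that by (simp add: P_def)
    thus ?thesis
      by blast
  qed
  also have "\<dots> \<longleftrightarrow> P \<and> noncrossing (set H)"
  proof -
    have "fst h < fst h' \<longleftrightarrow> h \<noteq> h' \<and> fst h \<le> fst h'" if "h \<in> set H" "h' \<in> set H" for h h'
      using inj_onD[OF inj_fst _ that] by force
    hence "(\<forall>h\<in>set H. \<forall>h'\<in>set H. fst h < fst h' \<longrightarrow> snd h \<le> fst h' \<or> snd h' < snd h) \<longleftrightarrow>
      (\<forall>h\<in>set H. \<forall>h'\<in>set H. h \<noteq> h' \<longrightarrow> fst h \<le> fst h' \<longrightarrow>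
        fst h < fst h' \<and> (snd h \<le> fst h' \<or> snd h' < snd h))"
      by blast
    moreover have "P \<Longrightarrow> \<forall>h\<in>set H. fst h < snd h"
      unfolding P_def by blast
    ultimately show ?thesis
      unfolding noncrossing_def by argo
  qed
  finally show ?thesis
    using True by (auto simp: P_def noncrossing_def)
qed

section \<open>Motzkin paths as ballot pairs\<close>

text \<open>The common target of all three classes. Letters are indexed by \<open>n, ..., 2\<close>
  in reading order, so the elements that are at least \<open>x\<close> are those of a prefix, and
  there are \<open>n - 1\<close> letters.\<close>

definition ballot_pairs :: "nat \<Rightarrow> (nat set \<times> nat set) set" where
  "ballot_pairs n = {(D, U). D \<subseteq> {2..n} \<and> U \<subseteq> {2..n} \<and> D \<inter> U = {} \<and> card D = card U \<and>
     (\<forall>x. card {d\<in>D. x \<le> d} \<le> card {u\<in>U. x \<le> u})}"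

definition ballot_path :: "nat \<Rightarrow> nat set \<Rightarrow> nat set \<Rightarrow> step list" where
  "ballot_path n D U =
     map (\<lambda>i. if i \<in> D then Down else if i \<in> U then Up else East) (rev [2..<Suc n])"

lemma count_list_map_rev_upt:
  "count_list (map f (rev [x..<Suc n])) s = card {i\<in>{x..n}. f i = s}"
proof -
  have "count_list (map f (rev [x..<Suc n])) s = length (filter (\<lambda>i. f i = s) (rev [x..<Suc n]))"
    by (simp add: count_list_eq_length_filter filter_map comp_def eq_commute[of s] del: upt_Suc)
  also have "\<dots> = card ({i. f i = s} \<inter> set (rev [x..<Suc n]))"
    by (rule distinct_length_filter) (simp del: upt_Suc)
  also have "{i. f i = s} \<inter> set (rev [x..<Suc n]) = {i\<in>{x..n}. f i = s}"
    by (auto simp del: upt_Suc)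
  finally show ?thesis .
qed

lemma prefix_map_rev_upt_iff:
  assumes "a \<le> Suc n"
  shows "prefix v (map f (rev [a..<Suc n])) \<longleftrightarrow> (\<exists>x\<ge>a. v = map f (rev [x..<Suc n]))"
proof
  assume "prefix v (map f (rev [a..<Suc n]))"
  then obtain k where v: "v = take k (map f (rev [a..<Suc n]))"
    by (metis append_eq_conv_conj prefix_def)
  have "v = map f (rev [a + (Suc n - a - k)..<Suc n])"
    by (simp add: v take_map take_rev del: upt_Suc)
  thus "\<exists>x\<ge>a. v = map f (rev [x..<Suc n])"
    by (intro exI[of _ "a + (Suc n - a - k)"]) simp
next
  assume "\<exists>x\<ge>a. v = map f (rev [x..<Suc n])"
  then obtain x where x: "x \<ge> a" "v = map f (rev [x..<Suc n])"
    by blast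
  show "prefix v (map f (rev [a..<Suc n]))"
  proof (cases "x \<le> Suc n")
    case True
    have "[a..<Suc n] = [a..<x] @ [x..<Suc n]"
      using upt_add_eq_append[of a x "Suc n - x"] x(1) True by simp
    hence "map f (rev [a..<Suc n]) = v @ map f (rev [a..<x])"
      by (simp add: x(2) del: upt_Suc)
    thus ?thesis
      by simp
  next
    \<comment> \<open>Beyond \<open>Suc n\<close> the interval is empty and yields the empty
      prefix.\<close>
    case False
    thus ?thesis
      by (simp add: x(2))
  qed
qed

lemma ballot_path_in_motzkin_paths_iff:
  assumes n: "n \<ge> 1" and D: "D \<subseteq> {2..n}" and U: "U \<subseteq> {2..n}" and disj: "D \<inter> U = {}"
  shows "ballot_path n D U \<in> motzkin_paths (n - 1) \<longleftrightarrow> (D, U) \<in> ballot_pairs n"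
proof -
  define f where "f i = (if i \<in> D then Down else if i \<in> U then Up else East)" for i
  have path: "ballot_path n D U = map f (rev [2..<Suc n])"
    by (simp add: ballot_path_def f_def)
  have down: "{i\<in>{x..n}. f i = Down} = {d\<in>D. x \<le> d}" and up: "{i\<in>{x..n}. f i = Up} = {u\<in>U. x \<le> u}" for x
    using D U disj by (auto simp: f_def)
  have all: "{d\<in>X. x \<le> d} = X" if "x \<le> 2" "X \<subseteq> {2..n}" for x X
    using that by auto
  have "ballot_path n D U \<in> motzkin_paths (n - 1) \<longleftrightarrow>
      card U = card D \<and> (\<forall>x\<ge>2. card {d\<in>D. x \<le> d} \<le> card {u\<in>U. x \<le> u})"
  proof -
    have "count_list (ballot_path n D U) Up = card U" "count_list (ballot_path n D U) Down = card D"
      unfolding path count_list_map_rev_upt up down all[OF order_refl D] all[OF order_refl U] by simp_all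
    moreover have "(\<forall>v. prefix v (ballot_path n D U) \<longrightarrow> count_list v Down \<le> count_list v Up) \<longleftrightarrow>
        (\<forall>x\<ge>2. card {d\<in>D. x \<le> d} \<le> card {u\<in>U. x \<le> u})"
    proof -
      have "2 \<le> Suc n"
        using n by simp
      have "(\<forall>v. prefix v (ballot_path n D U) \<longrightarrow> count_list v Down \<le> count_list v Up) \<longleftrightarrow>
          (\<forall>x\<ge>2. count_list (map f (rev [x..<Suc n])) Down \<le> count_list (map f (rev [x..<Suc n])) Up)"
        unfolding path prefix_map_rev_upt_iff[OF \<open>2 \<le> Suc n\<close>] by blast
      thus ?thesis
        unfolding count_list_map_rev_upt down up .
    qed
    moreover have "length (ballot_path n D U) = n - 1"
      unfolding path by (simp del: upt_Suc)
    ultimately show ?thesis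
      by (simp add: motzkin_paths_def)
  qed
  \<comment> \<open>Prefixes of the word correspond to thresholds from 2 on; smaller ones count the
    whole sets, where equality of cardinalities suffices.\<close>
  moreover have "(\<forall>x\<ge>2. card {d\<in>D. x \<le> d} \<le> card {u\<in>U. x \<le> u}) \<longleftrightarrow>
      (\<forall>x. card {d\<in>D. x \<le> d} \<le> card {u\<in>U. x \<le> u})" if "card U = card D"
  proof -
    have "card {d\<in>D. x \<le> d} \<le> card {u\<in>U. x \<le> u}" if "x \<le> 2" for x
      using all[OF that D] all[OF that U] \<open>card U = card D\<close> by simp
    thus ?thesis
      by (meson linear)
  qed
  ultimately show ?thesis
    using D U disj by (auto simp: ballot_pairs_def)
qed

lemma bij_betw_ballot_path:
  assumes n: "n \<ge> 1"
  shows "bij_betw (\<lambda>(D, U). ballot_path n D U) (ballot_pairs n) (motzkin_paths (n - 1))"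
proof (rule bij_betw_imageI)
  show "inj_on (\<lambda>(D, U). ballot_path n D U) (ballot_pairs n)"
  proof (rule inj_onI, clarify)
    fix D U D' U' assume DU: "(D, U) \<in> ballot_pairs n" "(D', U') \<in> ballot_pairs n"
      and eq: "ballot_path n D U = ballot_path n D' U'"
    have sub: "D \<subseteq> {2..n}" "U \<subseteq> {2..n}" "D' \<subseteq> {2..n}" "U' \<subseteq> {2..n}" and disj: "D \<inter> U = {}" "D' \<inter> U' = {}"
      using DU by (auto simp: ballot_pairs_def)
    have "\<forall>i\<in>{2..n}. (if i \<in> D then Down else if i \<in> U then Up else East) =
        (if i \<in> D' then Down else if i \<in> U' then Up else East)"
      using eq by (auto simp: ballot_path_def simp del: upt_Suc)
    hence "(i \<in> D \<longleftrightarrow> i \<in> D') \<and> (i \<in> U \<longleftrightarrow> i \<in> U')" if "i \<in> {2..n}" for i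
    proof -
      have "i \<notin> D \<or> i \<notin> U" "i \<notin> D' \<or> i \<notin> U'"
        using disj by blast+
      thus ?thesis
        using bspec[OF \<open>\<forall>i\<in>{2..n}. _ i\<close> that] by (auto split: if_splits)
    qed
    thus "D = D' \<and> U = U'"
      using sub by blast
  qed
  show "(\<lambda>(D, U). ballot_path n D U) ` ballot_pairs n = motzkin_paths (n - 1)"
  proof
    show "(\<lambda>(D, U). ballot_path n D U) ` ballot_pairs n \<subseteq> motzkin_paths (n - 1)"
    proof clarify
      fix D U assume "(D, U) \<in> ballot_pairs n"
      thus "ballot_path n D U \<in> motzkin_paths (n - 1)"
        using ballot_path_in_motzkin_paths_iff[OF n, of D U] by (auto simp: ballot_pairs_def)
    qed
    show "motzkin_paths (n - 1) \<subseteq> (\<lambda>(D, U). ballot_path n D U) ` ballot_pairs n"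
    proof
      fix w assume w: "w \<in> motzkin_paths (n - 1)"
      hence len: "length w = n - 1"
        by (simp add: motzkin_paths_def)
      \<comment> \<open>The word starts with the letter of \<open>n\<close> at list index 0, so the
        letter of \<open>i\<close> has index \<open>n - i\<close>.\<close>
      define D where "D = {i\<in>{2..n}. w ! (n - i) = Down}"
      define U where "U = {i\<in>{2..n}. w ! (n - i) = Up}"
      have "ballot_path n D U = w"
      proof (rule nth_equalityI)
        fix k assume "k < length (ballot_path n D U)"
        hence k: "k < n - 1"
          by (simp add: ballot_path_def del: upt_Suc)
        hence nth: "rev [2..<Suc n] ! k = n - k" and mem: "n - k \<in> {2..n}" and "n - (n - k) = k"
          by (auto simp: rev_nth nth_upt simp del: upt_Suc)
        thus "ballot_path n D U ! k = w ! k"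
          using k by (cases "w ! k") (auto simp: ballot_path_def D_def U_def nth_map simp del: upt_Suc)
      qed (use len in \<open>simp add: ballot_path_def del: upt_Suc\<close>)
      moreover have "D \<subseteq> {2..n}" "U \<subseteq> {2..n}" "D \<inter> U = {}"
        by (auto simp: D_def U_def)
      hence "(D, U) \<in> ballot_pairs n"
        using ballot_path_in_motzkin_paths_iff[OF n, of D U] w calculation by simp
      ultimately show "w \<in> (\<lambda>(D, U). ballot_path n D U) ` ballot_pairs n"
        by force
    qed
  qed
qed

text \<open>Necessity of the condition in \<open>noncrossing_exists\<close>: intervals that open at
  \<open>x\<close> or later have distinct closers, all strictly beyond \<open>x\<close>.\<close>

lemma noncrossing_card:
  assumes S: "noncrossing S" "finite S"
  shows "card (snd ` S) = card (fst ` S)"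
    and "card {d \<in> fst ` S. x \<le> d} \<le> card {c \<in> snd ` S. x < c}"
proof -
  show "card (snd ` S) = card (fst ` S)"
    using card_image[OF noncrossing_inj_fst[OF S(1)]] card_image[OF noncrossing_inj_snd[OF S(1)]] by simp
  let ?T = "{h \<in> S. x \<le> fst h}"
  have T: "noncrossing ?T"
    by (rule noncrossing_subset[OF S(1)]) auto
  have "{d \<in> fst ` S. x \<le> d} = fst ` ?T"
    by auto
  hence "card {d \<in> fst ` S. x \<le> d} = card (snd ` ?T)"
    using card_image[OF noncrossing_inj_fst[OF T]] card_image[OF noncrossing_inj_snd[OF T]] by simp
  also have "snd ` ?T \<subseteq> {c \<in> snd ` S. x < c}"
    using noncrossing_less[OF T] by fastforce
  hence "card (snd ` ?T) \<le> card {c \<in> snd ` S. x < c}"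
    using S(2) by (intro card_mono) auto
  finally show "card {d \<in> fst ` S. x \<le> d} \<le> card {c \<in> snd ` S. x < c}" .
qed

section \<open>Valid hook configurations determined by their closers\<close>

lemma in_AvD: "p \<in> Av n T \<Longrightarrow> p \<in> permutations_of_set {1..n}"
  by (simp add: Av_def)

lemma mem_VHC_iff:
  assumes "A \<subseteq> permutations_of_set {1..n}"
  shows "(p, H) \<in> VHC A \<longleftrightarrow> p \<in> A \<and> map fst H = sorted_list_of_set (descents p) \<and>
     noncrossing (set H) \<and> (\<forall>h\<in>set H. snd h \<le> n \<and> dominating p h)"
proof -
  have "inj_on (entry p) {1..length p}" "length p = n" if "p \<in> A"
    using bij_betw_entry[of p n] length_permutation[of p n] assms that by (auto simp: bij_betw_def)
  hence "p \<in> A \<and> valid_hook_configuration p H \<longleftrightarrow> p \<in> A \<and> map fst H = sorted_list_of_set (descents p) \<and>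
     noncrossing (set H) \<and> (\<forall>h\<in>set H. snd h \<le> n \<and> dominating p h)"
    using valid_hook_configuration_iff[of p H] by auto
  thus ?thesis
    by (simp add: VHC_def)
qed

lemma fst_image_hooks:
  assumes "map fst H = sorted_list_of_set (descents p)"
  shows "fst ` set H = descents p"
  using arg_cong[OF assms, of set] by (simp add: finite_descents)

lemma VHC_eqI:
  assumes A: "A \<subseteq> permutations_of_set {1..n}" and G: "(p, G) \<in> VHC A" and H: "(p, H) \<in> VHC A"
    and snd: "snd ` set G = snd ` set H"
  shows "G = H"
proof -
  have G': "map fst G = sorted_list_of_set (descents p)" "noncrossing (set G)"
    and H': "map fst H = sorted_list_of_set (descents p)" "noncrossing (set H)"
    using G H by (simp_all add: mem_VHC_iff[OF A])
  have "set G = set H"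
    using noncrossing_unique[OF finite_descents G'(2) H'(2) fst_image_hooks[OF G'(1)] fst_image_hooks[OF H'(1)] snd] .
  thus ?thesis
    using G'(1) H'(1) by (intro list_eqI_map_fst_set) simp_all
qed

lemma VHC_exists:
  assumes A: "A \<subseteq> permutations_of_set {1..n}" "p \<in> A"
    and S: "noncrossing S" "fst ` S = descents p" "\<And>h. h \<in> S \<Longrightarrow> snd h \<le> n \<and> dominating p h"
  obtains H where "(p, H) \<in> VHC A" "set H = S"
proof -
  have "finite S"
    using finite_imageD[OF _ noncrossing_inj_fst[OF S(1)]] S(2) finite_descents by simp
  then obtain H where "set H = S" "map fst H = sorted_list_of_set (fst ` S)"
    by (rule ex_list_map_fst[OF _ noncrossing_inj_fst[OF S(1)]])
  thus ?thesis
    using A S by (intro that[of H]) (simp_all add: mem_VHC_iff[OF A(1)])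
qed

lemma descents_subset:
  assumes "p \<in> permutations_of_set {1..n}"
  shows "descents p \<subseteq> {1..<n}"
  using length_permutation[OF assms] by (auto simp: descents_def)

lemma mem_descents_iff:
  assumes "p \<in> permutations_of_set {1..n}" "1 \<le> i" "i < n"
  shows "i \<in> descents p \<longleftrightarrow> entry p (Suc i) < entry p i"
  using length_permutation[OF assms(1)] assms(2,3) by (auto simp: descents_def)

section \<open>Permutations avoiding 312\<close>

text \<open>If an entry before the ascent exceeded its top, that entry and the two entries of the
  ascent would form a 312.\<close>

lemma ascent_top_of_Av_312:
  assumes p: "p \<in> Av n {[3,1,2]}" and i: "1 \<le> i" "i < j" "j \<le> n"
    and asc: "j - 1 \<notin> descents p"
  shows "entry p i < entry p j"
proof -
  have perm: "p \<in> permutations_of_set {1..n}"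
    and avoid: "\<not> contains_pattern p [3,1,2]"
    using p by (auto simp: Av_def)
  have "j - 1 \<in> {1..n}" "i \<in> {1..n}" "j \<in> {1..n}" "j - 1 \<noteq> j"
    using i by auto
  hence "entry p (j - 1) \<noteq> entry p j" "entry p i \<noteq> entry p j"
    using entry_eq_iff[OF perm, of "j - 1" j] entry_eq_iff[OF perm, of i j] i by simp_all
  moreover have "\<not> entry p j < entry p (j - 1)"
    using mem_descents_iff[OF perm, of "j - 1"] asc i by simp
  ultimately have "entry p (j - 1) < entry p j"
    by simp
  show ?thesis
  proof (cases "i = j - 1")
    case False
    hence "i < j - 1" "j - 1 < j" "j \<le> length p"
      using i length_permutation[OF perm] by auto
    hence "\<not> entry p j < entry p i"
      using avoid[unfolded not_contains_312, rule_format, of i "j - 1" j] i \<open>entry p (j - 1) < entry p j\<close> by blast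
    thus ?thesis
      using \<open>entry p i \<noteq> entry p j\<close> by simp
  qed (use \<open>entry p (j - 1) < entry p j\<close> in simp)
qed

text \<open>Serves both classes avoiding 312; they differ only in how a descent set is turned into a
  permutation. A closer is an ascent top, hence not a descent bottom; conversely every position from
  2 on that is not a descent bottom dominates all earlier ones, so domination restricts the matching
  no further.\<close>

lemma bij_betw_VHC_ballot_pairs:
  assumes A: "A \<subseteq> Av n {[3,1,2]}" and bij: "bij_betw descents A (Pow {1..<n})"
  shows "bij_betw (\<lambda>(p, H). (Suc ` descents p, snd ` set H)) (VHC A) (ballot_pairs n)"
proof (rule bij_betw_imageI)
  have perms: "A \<subseteq> permutations_of_set {1..n}"
    using A by (auto simp: Av_def)
  show "inj_on (\<lambda>(p, H). (Suc ` descents p, snd ` set H)) (VHC A)"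
  proof (rule inj_onI, clarify)
    fix p G q H assume *: "(p, G) \<in> VHC A" "(q, H) \<in> VHC A" "Suc ` descents p = Suc ` descents q"
      "snd ` set G = snd ` set H"
    have "p = q"
      using * bij inj_image_eq_iff[OF inj_Suc, of "descents p" "descents q"]
      by (auto simp: bij_betw_def mem_VHC_iff[OF perms] inj_on_def)
    thus "p = q \<and> G = H"
      using VHC_eqI[OF perms] * by blast
  qed
  have Suc_ge: "{d \<in> Suc ` X. x \<le> d} = Suc ` {d \<in> X. x - 1 \<le> d}" for x X
    by auto
  have card_Suc_ge: "card {d \<in> Suc ` X. x \<le> d} = card {d \<in> X. x - 1 \<le> d}" for x X
    by (subst Suc_ge, rule card_image) simp
  show "(\<lambda>(p, H). (Suc ` descents p, snd ` set H)) ` VHC A = ballot_pairs n"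
  proof safe
    fix p H assume "(p, H) \<in> VHC A"
    hence p: "p \<in> A" and H: "map fst H = sorted_list_of_set (descents p)" "noncrossing (set H)"
      and dom: "\<And>h. h \<in> set H \<Longrightarrow> snd h \<le> n \<and> dominating p h"
      by (simp_all add: mem_VHC_iff[OF perms])
    have perm: "p \<in> permutations_of_set {1..n}"
      using p perms by blast
    note fst = fst_image_hooks[OF H(1)]
    have snd: "u \<in> {2..n} \<and> u \<notin> Suc ` descents p" if "u \<in> snd ` set H" for u
    proof -
      obtain i where i: "(i, u) \<in> set H"
        using \<open>u \<in> snd ` set H\<close> by auto
      have "i < u"
        using noncrossing_less[OF H(2) i] by simp
      have "i \<in> descents p"
        using fst i by force
      hence "1 \<le> i"
        by (simp add: descents_def)
      have "u \<le> n"
        using dom[OF i] by simp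
      have "entry p (u - 1) < entry p u"
        using dom[OF i] \<open>i < u\<close> by (simp add: dominating_def)
      hence "u - 1 \<notin> descents p"
        using mem_descents_iff[OF perm, of "u - 1"] \<open>i < u\<close> \<open>1 \<le> i\<close> \<open>u \<le> n\<close> by simp
      thus ?thesis
        using \<open>i < u\<close> \<open>1 \<le> i\<close> \<open>u \<le> n\<close> by force
    qed
    have ballot: "card {d \<in> Suc ` descents p. x \<le> d} \<le> card {u \<in> snd ` set H. x \<le> u}" for x
    proof -
      have "card {d \<in> Suc ` descents p. x \<le> d} \<le> card {u \<in> snd ` set H. x - 1 < u}"
        unfolding card_Suc_ge using noncrossing_card(2)[OF H(2), of "x - 1"] by (simp add: fst)
      \<comment> \<open>At \<open>x = 0\<close> the subtraction is truncated; the equality survives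
        because closers are at least 2.\<close>
      also have "{u \<in> snd ` set H. x - 1 < u} = {u \<in> snd ` set H. x \<le> u}"
        using snd by fastforce
      finally show ?thesis .
    qed
    have "card (Suc ` descents p) = card (snd ` set H)"
      using noncrossing_card(1)[OF H(2)] fst by (simp add: card_image)
    moreover have "Suc ` descents p \<subseteq> {2..n}"
      using descents_subset[OF perm] by fastforce
    ultimately show "(Suc ` descents p, snd ` set H) \<in> ballot_pairs n"
      using subsetI[of "snd ` set H" "{2..n}"] snd ballot by (simp add: ballot_pairs_def disjoint_iff) blast
  next
    fix D U assume DU: "(D, U) \<in> ballot_pairs n"
    have sub: "D \<subseteq> {2..n}" "U \<subseteq> {2..n}" "D \<inter> U = {}" and card: "card D = card U"
      and ballot: "\<And>x. card {d\<in>D. x \<le> d} \<le> card {u\<in>U. x \<le> u}"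
      using DU by (auto simp: ballot_pairs_def)
    define D' where "D' = (\<lambda>i. i - 1) ` D"
    have D: "Suc ` D' = D"
      using sub(1) by (force simp: D'_def image_image)
    have "D' \<in> Pow {1..<n}"
      using sub(1) by (force simp: D'_def)
    hence "D' \<in> descents ` A"
      using bij by (simp add: bij_betw_def)
    then obtain p where p: "p \<in> A" "descents p = D'"
      by blast
    have "\<exists>S. noncrossing S \<and> fst ` S = D' \<and> snd ` S = U"
    proof (rule noncrossing_exists)
      show "finite D'" "finite U"
        using finite_subset[OF sub(1)] finite_subset[OF sub(2)] by (simp_all add: D'_def)
      show "card U = card D'"
        using card D by (metis card_image inj_Suc)
      have "card {d\<in>D'. x \<le> d} \<le> card {u\<in>U. x < u}" for x
        using ballot[of "Suc x"] card_Suc_ge[of D' "Suc x"] by (simp add: D Suc_le_eq)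
      thus "\<forall>x. card {d\<in>D'. x \<le> d} \<le> card {u\<in>U. x < u}"
        by blast
    qed
    then obtain S where S: "noncrossing S" "fst ` S = D'" "snd ` S = U"
      by blast
    have dom: "snd h \<le> n \<and> dominating p h" if h: "h \<in> S" for h
    proof
      have "snd h \<in> U" "fst h \<in> D'"
        using S h by auto
      hence u: "snd h \<in> {2..n}" "snd h \<notin> D" and "1 \<le> fst h"
        using sub \<open>D' \<in> Pow {1..<n}\<close> by auto
      thus "snd h \<le> n"
        by simp
      have "Suc (snd h - 1) \<notin> Suc ` D'"
        using u D by simp
      hence "snd h - 1 \<notin> descents p"
        using p by blast
      thus "dominating p h"
        unfolding dominating_def using ascent_top_of_Av_312[of p n] p A u \<open>1 \<le> fst h\<close> by auto
    qed
    obtain H where "(p, H) \<in> VHC A" "set H = S"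
      using VHC_exists[OF perms p(1) S(1) _ dom] S(2) p(2) by auto
    thus "(D, U) \<in> (\<lambda>(p, H). (Suc ` descents p, snd ` set H)) ` VHC A"
      using p(2) D S(3) by force
  qed
qed

subsection \<open>Avoiding 231 and 312\<close>

text \<open>An ascent from \<open>k\<close> to \<open>Suc k\<close> between \<open>i\<close> and
  \<open>j\<close> puts \<open>entry p (Suc k)\<close> above \<open>entry p i\<close>; an inversion
  of \<open>i\<close> and \<open>j\<close> would then complete a 231. So inversions stay inside
  decreasing blocks, and the descent set fixes them all.\<close>

lemma descent_interval_of_Av_231_312:
  assumes p: "p \<in> Av n {[2,3,1], [3,1,2]}" and ij: "1 \<le> i" "i < j" "j \<le> n"
  shows "entry p j < entry p i \<longleftrightarrow> {i..<j} \<subseteq> descents p"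
proof
  have perm: "p \<in> permutations_of_set {1..n}" and p312: "p \<in> Av n {[3,1,2]}"
    and avoid: "\<not> contains_pattern p [2,3,1]"
    using p by (auto simp: Av_def)
  {
    assume less: "entry p j < entry p i"
    show "{i..<j} \<subseteq> descents p"
    proof (rule ccontr)
      assume "\<not> {i..<j} \<subseteq> descents p"
      then obtain k where k: "i \<le> k" "k < j" "k \<notin> descents p"
        by (meson atLeastLessThan_iff subsetI)
      have "entry p i < entry p (Suc k)"
        using ascent_top_of_Av_312[OF p312, of i "Suc k"] k ij by simp
      moreover from this have "Suc k \<noteq> j"
        using less by auto
      ultimately show False
        using avoid[unfolded not_contains_231, rule_format, of i "Suc k" j] k ij less
          length_permutation[OF perm] by simp
    qed
  next
    assume desc: "{i..<j} \<subseteq> descents p"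
    have "Suc i \<le> j" "j \<le> j"
      using ij by simp_all
    have "entry p k < entry p i" if "Suc i \<le> k" "k \<le> j" for k
      using that
    proof (induction k rule: dec_induct)
      case base
      thus ?case
        using desc ij by (auto simp: descents_def)
    next
      case (step k)
      have "k \<in> descents p"
        using desc step by auto
      thus ?case
        using step by (auto simp: descents_def)
    qed
    thus "entry p j < entry p i"
      using ij by simp
  }
qed

lemma bij_betw_descents_Av_231_312:
  "bij_betw descents (Av n {[2,3,1], [3,1,2]}) (Pow {1..<n})"
proof (rule bij_betw_imageI)
  show "inj_on descents (Av n {[2,3,1], [3,1,2]})"
  proof (rule inj_onI)
    fix p q assume *: "p \<in> Av n {[2,3,1], [3,1,2]}" "q \<in> Av n {[2,3,1], [3,1,2]}" "descents p = descents q"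
    show "p = q"
      using descent_interval_of_Av_231_312[OF *(1)] descent_interval_of_Av_231_312[OF *(2)] *(3)
      by (intro permutation_eqI[OF in_AvD[OF *(1)] in_AvD[OF *(2)]]) simp
  qed
  show "descents ` Av n {[2,3,1], [3,1,2]} = Pow {1..<n}"
  proof
    show "descents ` Av n {[2,3,1], [3,1,2]} \<subseteq> Pow {1..<n}"
      using descents_subset in_AvD by blast
    show "Pow {1..<n} \<subseteq> descents ` Av n {[2,3,1], [3,1,2]}"
    proof
      fix S assume "S \<in> Pow {1..<n}"
      \<comment> \<open>\<open>b i\<close> is the index of the decreasing block that contains position \<open>i\<close>.\<close>
      define b where "b i = card ({1..<i} - S)" for i
      have b_mono: "b i \<le> b j" if "i \<le> j" for i j
        unfolding b_def by (rule card_mono) (use that in auto)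
      have b_Suc: "b (Suc i) = (if i \<in> S then b i else Suc (b i))" if "1 \<le> i" for i
      proof -
        have "{1..<Suc i} - S = (if i \<in> S then {1..<i} - S else insert i ({1..<i} - S))"
          using that by (auto simp: less_Suc_eq)
        thus ?thesis
          by (simp add: b_def)
      qed
      \<comment> \<open>Blocks increase from left to right, and positions are reversed inside a
        block.\<close>
      define R where "R i j \<longleftrightarrow> b i < b j \<or> b i = b j \<and> j < i" for i j
      obtain p where p: "p \<in> permutations_of_set {1..n}"
        and less: "\<And>i j. i \<in> {1..n} \<Longrightarrow> j \<in> {1..n} \<Longrightarrow> entry p i < entry p j \<longleftrightarrow> R i j"
        by (rule ex_permutation_of_order[of R n]) (auto simp: R_def)
      \<comment> \<open>In both forbidden patterns the first and last letters are inverted, which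
        puts them, and everything between them, into one block; a block is decreasing, but both
        patterns contain an ascent.\<close>
      have "\<not> contains_pattern p [2,3,1]"
        unfolding not_contains_231 length_permutation[OF p]
      proof (intro allI impI notI)
        fix i j k assume ijk: "1 \<le> i" "i < j" "j < k" "k \<le> n"
          and "entry p k < entry p i" "entry p i < entry p j"
        hence "R k i" "R i j"
          using less[of k i] less[of i j] by auto
        thus False
          using b_mono[of i j] b_mono[of j k] ijk by (auto simp: R_def)
      qed
      moreover have "\<not> contains_pattern p [3,1,2]"
        unfolding not_contains_312 length_permutation[OF p]
      proof (intro allI impI notI)
        fix i j k assume ijk: "1 \<le> i" "i < j" "j < k" "k \<le> n"
          and "entry p j < entry p k" "entry p k < entry p i"
        hence "R j k" "R k i"
          using less[of j k] less[of k i] by auto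
        thus False
          using b_mono[of i j] b_mono[of j k] ijk by (auto simp: R_def)
      qed
      ultimately have "p \<in> Av n {[2,3,1], [3,1,2]}"
        using p by (simp add: Av_def)
      moreover have "i \<in> descents p \<longleftrightarrow> i \<in> S" if "1 \<le> i" "i < n" for i
        using mem_descents_iff[OF p that] less[of "Suc i" i] that b_Suc[of i] by (simp add: R_def)
      hence "descents p = S"
        using \<open>S \<in> Pow {1..<n}\<close> descents_subset[OF p] by fastforce
      ultimately show "S \<in> descents ` Av n {[2,3,1], [3,1,2]}"
        by blast
    qed
  qed
qed

subsection \<open>Avoiding 132 and 312\<close>

text \<open>The step into \<open>j\<close> decides its comparison with all earlier positions: an
  ascent makes it a new maximum, while after a descent a smaller earlier entry would give a
  132.\<close>

lemma descent_of_Av_132_312: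
  assumes p: "p \<in> Av n {[1,3,2], [3,1,2]}" and ij: "1 \<le> i" "i < j" "j \<le> n"
  shows "entry p j < entry p i \<longleftrightarrow> j - 1 \<in> descents p"
proof -
  have perm: "p \<in> permutations_of_set {1..n}" and p312: "p \<in> Av n {[3,1,2]}"
    and avoid: "\<not> contains_pattern p [1,3,2]"
    using p by (auto simp: Av_def)
  have ne: "entry p i \<noteq> entry p j"
    using entry_eq_iff[OF perm, of i j] ij by auto
  show ?thesis
  proof (cases "j - 1 \<in> descents p")
    case True
    hence less: "entry p j < entry p (j - 1)"
      using mem_descents_iff[OF perm, of "j - 1"] ij by simp
    have "entry p j < entry p i"
    proof (cases "i = j - 1")
      case False
      hence "i < j - 1" "j - 1 < j"
        using ij by auto
      hence "\<not> entry p i < entry p j"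
        using avoid[unfolded not_contains_132, rule_format, of i "j - 1" j] ij less
          length_permutation[OF perm] by blast
      thus ?thesis
        using ne by simp
    qed (use less in simp)
    thus ?thesis
      using True by simp
  next
    case False
    thus ?thesis
      using ascent_top_of_Av_312[OF p312 ij] by simp
  qed
qed

lemma bij_betw_descents_Av_132_312:
  "bij_betw descents (Av n {[1,3,2], [3,1,2]}) (Pow {1..<n})"
proof (rule bij_betw_imageI)
  show "inj_on descents (Av n {[1,3,2], [3,1,2]})"
  proof (rule inj_onI)
    fix p q assume *: "p \<in> Av n {[1,3,2], [3,1,2]}" "q \<in> Av n {[1,3,2], [3,1,2]}" "descents p = descents q"
    show "p = q"
      using descent_of_Av_132_312[OF *(1)] descent_of_Av_132_312[OF *(2)] *(3)
      by (intro permutation_eqI[OF in_AvD[OF *(1)] in_AvD[OF *(2)]]) simp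
  qed
  show "descents ` Av n {[1,3,2], [3,1,2]} = Pow {1..<n}"
  proof
    show "descents ` Av n {[1,3,2], [3,1,2]} \<subseteq> Pow {1..<n}"
      using descents_subset in_AvD by blast
    show "Pow {1..<n} \<subseteq> descents ` Av n {[1,3,2], [3,1,2]}"
    proof
      fix S assume "S \<in> Pow {1..<n}"
      \<comment> \<open>Every entry is a new minimum or a new maximum, according to the sign of its key.\<close>
      define key where "key i = (if i - 1 \<in> S then - int i else int i)" for i
      have abs: "\<bar>key i\<bar> = int i" for i
        by (simp add: key_def)
      hence key_inj: "key i = key j \<longleftrightarrow> i = j" for i j
        by (metis of_nat_eq_iff)
      obtain p where p: "p \<in> permutations_of_set {1..n}"
        and less: "\<And>i j. i \<in> {1..n} \<Longrightarrow> j \<in> {1..n} \<Longrightarrow> entry p i < entry p j \<longleftrightarrow> key i < key j"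
        by (rule ex_permutation_of_order[of "\<lambda>i j. key i < key j" n]) (auto simp: key_inj neq_iff[symmetric])
      \<comment> \<open>The key of the largest absolute value cannot lie between two others, whereas
        the last letter of 132 and of 312 is the middle value.\<close>
      have extremal: "\<not> (key i < key k \<and> key k < key j) \<and> \<not> (key j < key k \<and> key k < key i)"
        if "i < k" "j < k" for i j k
        using abs[of i] abs[of j] abs[of k] that by linarith
      have "\<not> contains_pattern p [1,3,2]" "\<not> contains_pattern p [3,1,2]"
        unfolding not_contains_132 not_contains_312 length_permutation[OF p]
        using less extremal by (auto dest: less_trans)
      hence "p \<in> Av n {[1,3,2], [3,1,2]}"
        using p by (simp add: Av_def)
      moreover have "i \<in> descents p \<longleftrightarrow> i \<in> S" if "1 \<le> i" "i < n" for i
        using mem_descents_iff[OF p that] less[of "Suc i" i] that abs[of i] by (auto simp: key_def[of "Suc i"])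
      hence "descents p = S"
        using \<open>S \<in> Pow {1..<n}\<close> descents_subset[OF p] by fastforce
      ultimately show "S \<in> descents ` Av n {[1,3,2], [3,1,2]}"
        by blast
    qed
  qed
qed

section \<open>Permutations avoiding 132 and 231\<close>

text \<open>The value 1 can play the last letter of a 231 and the first letter of a 132. This
  forbids ascents among the entries to its left and inversions among those to its right.\<close>

lemma Av_132_231_valley:
  assumes p: "p \<in> Av n {[1,3,2], [2,3,1]}" and n: "n \<ge> 1"
  obtains m where "m \<in> {1..n}" "entry p m = 1" "descents p = {1..<m}"
    "\<And>i j. 1 \<le> i \<Longrightarrow> i < j \<Longrightarrow> j \<le> m \<Longrightarrow> entry p j < entry p i"
    "\<And>i j. m \<le> i \<Longrightarrow> i < j \<Longrightarrow> j \<le> n \<Longrightarrow> entry p i < entry p j"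
proof -
  have perm: "p \<in> permutations_of_set {1..n}"
    and avoid: "\<not> contains_pattern p [1,3,2]" "\<not> contains_pattern p [2,3,1]"
    using p by (auto simp: Av_def)
  have "1 \<in> entry p ` {1..n}"
    using bij_betw_entry[OF perm] n by (simp add: bij_betw_def)
  then obtain m where m: "m \<in> {1..n}" "entry p m = 1"
    by force
  have min: "entry p m < entry p i" if "i \<in> {1..n}" "i \<noteq> m" for i
    using entry_in[OF perm that(1)] entry_eq_iff[OF perm that(1) m(1)] that(2) m(2) by simp
  have dec: "entry p j < entry p i" if ij: "1 \<le> i" "i < j" "j \<le> m" for i j
  proof (cases "j = m")
    case True
    thus ?thesis
      using min[of i] ij m(1) by simp
  next
    case False
    hence "entry p m < entry p i"
      using min[of i] ij m(1) by simp
    hence "\<not> entry p i < entry p j"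
      using avoid(2)[unfolded not_contains_231, rule_format, of i j m] ij m(1) False
        length_permutation[OF perm] by simp
    thus ?thesis
      using entry_eq_iff[OF perm, of i j] ij m(1) by simp
  qed
  have inc: "entry p i < entry p j" if ij: "m \<le> i" "i < j" "j \<le> n" for i j
  proof (cases "i = m")
    case True
    thus ?thesis
      using min[of j] ij m(1) by simp
  next
    case False
    hence "entry p m < entry p j"
      using min[of j] ij m(1) by simp
    hence "\<not> entry p j < entry p i"
      using avoid(1)[unfolded not_contains_132, rule_format, of m i j] ij m(1) False
        length_permutation[OF perm] by simp
    thus ?thesis
      using entry_eq_iff[OF perm, of i j] ij m(1) by simp
  qed
  have "i \<in> descents p \<longleftrightarrow> i < m" if "i \<in> {1..<n}" for i
    using mem_descents_iff[OF perm, of i] dec[of i "Suc i"] inc[of i "Suc i"] that by fastforce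
  hence "descents p = {1..<m}"
    using descents_subset[OF perm] m(1) by fastforce
  thus ?thesis
    using m dec inc that by blast
qed

text \<open>\<open>D\<close> is meant as the set of values to the left of 1, the heights of the
  descent tops. For \<open>D\<close> within \<open>{2..n}\<close> the value 1 heads the second
  list.\<close>

definition valley_list :: "nat \<Rightarrow> nat set \<Rightarrow> nat list" where
  "valley_list n D = rev (sorted_list_of_set D) @ sorted_list_of_set ({1..n} - D)"

lemma entry_image:
  assumes m: "m \<le> Suc (length p)"
  shows "entry p ` {1..<m} = set (take (m - 1) p)"
proof -
  have "{1..<m} = Suc ` {0..<m - 1}"
    by (cases m) (simp_all add: image_Suc_atLeastLessThan)
  moreover have "entry p ` Suc ` X = (!) p ` X" for X
    by (simp add: image_image entry_def)
  ultimately have "entry p ` {1..<m} = (!) p ` {0..<m - 1}"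
    by metis
  also have "\<dots> = set (take (m - 1) p)"
    using m by (intro nth_image) simp
  finally show ?thesis .
qed

text \<open>Both runs are monotone, hence determined by their sets of values. In this class the
  values of the descent tops replace the descent set as the parameter.\<close>

lemma Av_132_231_eq_valley_list:
  assumes p: "p \<in> Av n {[1,3,2], [2,3,1]}" and n: "n \<ge> 1"
  shows "p = valley_list n (entry p ` descents p)"
proof -
  obtain m where m: "m \<in> {1..n}" "descents p = {1..<m}"
    and dec: "\<And>i j. 1 \<le> i \<Longrightarrow> i < j \<Longrightarrow> j \<le> m \<Longrightarrow> entry p j < entry p i"
    and inc: "\<And>i j. m \<le> i \<Longrightarrow> i < j \<Longrightarrow> j \<le> n \<Longrightarrow> entry p i < entry p j"
    using Av_132_231_valley[OF p n] by metis
  note perm = in_AvD[OF p]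
  note len = length_permutation[OF perm]
  have set: "set p = {1..n}" and distinct: "distinct p"
    using permutations_of_setD[OF perm] by auto
  let ?l = "take (m - 1) p" and ?r = "drop (m - 1) p"
  have "sorted_wrt (>) ?l"
    using m(1) len unfolding sorted_wrt_iff_nth_less
    by (auto simp: nth_eq_entry[of p] intro!: dec)
  hence "sorted_list_of_set (set (rev ?l)) = rev ?l"
    using distinct by (intro sorted_list_of_set.idem_if_sorted_distinct)
      (auto simp: sorted_wrt_rev intro: sorted_wrt_mono_rel[rotated])
  hence l: "rev (sorted_list_of_set (set ?l)) = ?l"
    by simp
  have "sorted_wrt (<) ?r"
    using m(1) len unfolding sorted_wrt_iff_nth_less
    by (auto simp: nth_eq_entry[of p] intro!: inc)
  hence r: "sorted_list_of_set (set ?r) = ?r"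
    using distinct by (intro sorted_list_of_set.idem_if_sorted_distinct)
      (auto intro: sorted_wrt_mono_rel[rotated])
  have "set ?l \<union> set ?r = {1..n}" "set ?l \<inter> set ?r = {}"
    using set distinct by (metis append_take_drop_id set_append, metis append_take_drop_id distinct_append)
  hence "set ?r = {1..n} - set ?l"
    by blast
  moreover have "entry p ` descents p = set ?l"
    using m len entry_image[of m p] by simp
  ultimately show ?thesis
    unfolding valley_list_def using l r by (metis append_take_drop_id)
qed

lemma valley_list_in_Av:
  assumes D: "D \<subseteq> {2..n}" and n: "n \<ge> 1"
  shows "valley_list n D \<in> Av n {[1,3,2], [2,3,1]}"
    and "entry (valley_list n D) ` descents (valley_list n D) = D"
proof -
  define p where "p = valley_list n D"
  define xs ys where "xs = sorted_list_of_set D" and "ys = sorted_list_of_set ({1..n} - D)"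
  have p_eq: "p = rev xs @ ys"
    by (simp add: p_def valley_list_def xs_def ys_def)
  have "finite D"
    using D finite_subset by blast
  hence set: "set xs = D" "set ys = {1..n} - D"
    by (simp_all add: xs_def ys_def)
  have perm: "p \<in> permutations_of_set {1..n}"
    using set D by (intro permutations_of_setI) (auto simp: p_eq xs_def ys_def)
  note len = length_permutation[OF perm]
  have sorted: "sorted_wrt (<) xs" "sorted_wrt (<) ys"
    by (simp_all add: xs_def ys_def)
  have left: "entry p i = rev xs ! (i - 1)" if "1 \<le> i" "i \<le> length xs" for i
  proof -
    have "i - 1 < length (rev xs)"
      using that by simp
    thus ?thesis
      by (simp add: entry_def p_eq nth_append)
  qed
  have right: "entry p i = ys ! (i - 1 - length xs)" if "length xs < i" for i
  proof -
    have "\<not> i - 1 < length (rev xs)"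
      using that by simp
    thus ?thesis
      by (simp add: entry_def p_eq nth_append)
  qed
  have dec: "entry p j < entry p i" if "1 \<le> i" "i < j" "j \<le> length xs" for i j
  proof -
    have "sorted_wrt (\<lambda>x y. y < x) (rev xs)"
      using sorted(1) by (simp add: sorted_wrt_rev)
    thus ?thesis
      using sorted_wrt_nth_less[of "\<lambda>x y. y < x" "rev xs" "i - 1" "j - 1"] that by (simp add: left)
  qed
  have inc: "entry p i < entry p j" if "length xs < i" "i < j" "j \<le> n" for i j
  proof -
    have "length xs + length ys = n"
      using len by (simp add: p_eq)
    thus ?thesis
      using sorted_wrt_nth_less[OF sorted(2), of "i - 1 - length xs" "j - 1 - length xs"] that
      by (simp add: right)
  qed
  \<comment> \<open>Both 132 and 231 have their largest letter in the middle.\<close>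
  have no_peak: "\<not> (entry p i < entry p j \<and> entry p k < entry p j)"
    if "1 \<le> i" "i < j" "j < k" "k \<le> n" for i j k
    using dec[of i j] inc[of j k] that by (cases "j \<le> length xs") auto
  have "\<not> contains_pattern p [1,3,2]" "\<not> contains_pattern p [2,3,1]"
    unfolding not_contains_132 not_contains_231 len using no_peak by (meson less_trans)+
  thus Av: "valley_list n D \<in> Av n {[1,3,2], [2,3,1]}"
    using perm by (simp add: Av_def p_def)
  obtain m where m: "m \<in> {1..n}" "entry p m = 1" "descents p = {1..<m}"
    using Av_132_231_valley[OF Av n] unfolding p_def by metis
  have img: "entry p ` {1..<Suc (length xs)} = D"
    using entry_image[of "Suc (length xs)" p] set(1) by (simp add: p_eq)
  \<comment> \<open>The minimum is not in \<open>D\<close>, so it lies in the increasing run and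
    must be its first entry; this locates the end of the descents.\<close>
  have "\<not> m \<le> length xs"
  proof
    assume "m \<le> length xs"
    hence "entry p m \<in> D"
      using img m(1) by auto
    thus False
      using D m(2) by auto
  qed
  moreover have "\<not> Suc (length xs) < m"
  proof
    assume *: "Suc (length xs) < m"
    hence "entry p (Suc (length xs)) < 1"
      using inc[of "Suc (length xs)" m] m by simp
    moreover have "entry p (Suc (length xs)) \<in> {1..n}"
      using * m(1) by (intro entry_in[OF perm]) simp
    ultimately show False
      by simp
  qed
  ultimately have "m = Suc (length xs)"
    by simp
  thus "entry (valley_list n D) ` descents (valley_list n D) = D"
    using m(3) img by (simp add: p_def)
qed

text \<open>All openers lie left of the position \<open>m\<close> of the value 1 and all closers
  right of it, so hooks are nested: the highest opener is paired with the highest closer, the second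
  highest with the second highest, and so on. That all hooks go up is then the ballot condition on
  values.\<close>

lemma bij_betw_VHC_Av_132_231:
  assumes n: "n \<ge> 1"
  shows "bij_betw (\<lambda>(p, H). (entry p ` descents p, entry p ` snd ` set H))
    (VHC (Av n {[1,3,2], [2,3,1]})) (ballot_pairs n)"
proof (rule bij_betw_imageI)
  let ?A = "Av n {[1,3,2], [2,3,1]}"
  have perms: "?A \<subseteq> permutations_of_set {1..n}"
    by (auto simp: Av_def)
  have inj: "inj_on (entry p) {1..n}" if "p \<in> ?A" for p
    using bij_betw_entry[of p n] that perms by (auto simp: bij_betw_def)
  have snd_in: "snd ` set H \<subseteq> {1..n}" if "(p, H) \<in> VHC ?A" for p H
  proof -
    have "noncrossing (set H)" "\<forall>h\<in>set H. snd h \<le> n"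
      using that unfolding mem_VHC_iff[OF perms] by blast+
    thus ?thesis
      using noncrossing_less[of "set H"] by fastforce
  qed
  show "inj_on (\<lambda>(p, H). (entry p ` descents p, entry p ` snd ` set H)) (VHC ?A)"
  proof (rule inj_onI, clarify)
    fix p G q H assume *: "(p, G) \<in> VHC ?A" "(q, H) \<in> VHC ?A"
      "entry p ` descents p = entry q ` descents q" "entry p ` snd ` set G = entry q ` snd ` set H"
    have A: "p \<in> ?A" "q \<in> ?A"
      using *(1,2) unfolding mem_VHC_iff[OF perms] by blast+
    have pq: "p = q"
      using Av_132_231_eq_valley_list[OF A(1) n] Av_132_231_eq_valley_list[OF A(2) n] *(3) by metis
    have "entry p ` snd ` set G = entry p ` snd ` set H"
      using *(4) unfolding pq .
    hence "snd ` set G = snd ` set H"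
      using inj_on_image_eq_iff[OF inj[OF A(1)] snd_in[OF *(1)] snd_in[OF *(2)]] by blast
    moreover have "(p, H) \<in> VHC ?A"
      using *(2) unfolding pq .
    ultimately show "p = q \<and> G = H"
      using VHC_eqI[OF perms *(1)] pq by blast
  qed
  show "(\<lambda>(p, H). (entry p ` descents p, entry p ` snd ` set H)) ` VHC ?A = ballot_pairs n"
  proof safe
    fix p H assume VHC: "(p, H) \<in> VHC ?A"
    hence p: "p \<in> ?A" and H: "map fst H = sorted_list_of_set (descents p)" "noncrossing (set H)"
      and dom: "\<And>h. h \<in> set H \<Longrightarrow> snd h \<le> n \<and> dominating p h"
      unfolding mem_VHC_iff[OF perms] by blast+
    have perm: "p \<in> permutations_of_set {1..n}"
      using p perms by blast
    obtain m where m: "m \<in> {1..n}" "entry p m = 1" "descents p = {1..<m}"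
      and dec: "\<And>i j. 1 \<le> i \<Longrightarrow> i < j \<Longrightarrow> j \<le> m \<Longrightarrow> entry p j < entry p i"
      and inc: "\<And>i j. m \<le> i \<Longrightarrow> i < j \<Longrightarrow> j \<le> n \<Longrightarrow> entry p i < entry p j"
      using Av_132_231_valley[OF p n] by metis
    have fst: "fst ` set H = {1..<m}"
      using fst_image_hooks[OF H(1)] m by simp
    have hook: "1 \<le> fst h" "fst h < m" "m < snd h" "snd h \<le> n" "entry p (fst h) < entry p (snd h)"
      if h: "h \<in> set H" for h
    proof -
      have "fst h \<in> {1..<m}"
        using fst h by blast
      thus 1: "1 \<le> fst h" "fst h < m"
        by auto
      show "snd h \<le> n"
        using dom[OF h] by simp
      have "fst h < snd h"
        using noncrossing_less[OF H(2) h] .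
      thus "entry p (fst h) < entry p (snd h)"
        using dom[OF h] by (simp add: dominating_def)
      thus "m < snd h"
        using dec[of "fst h" "snd h"] 1 \<open>fst h < snd h\<close> by force
    qed
    let ?D = "entry p ` descents p" and ?U = "entry p ` snd ` set H"
    have desc_n: "descents p \<subseteq> {1..n}"
      using m by auto
    have snd_m: "snd ` set H \<subseteq> {m<..n}"
      using hook by auto
    hence snd_n: "snd ` set H \<subseteq> {1..n}"
      using m(1) by auto
    have ge2: "entry p i \<in> {2..n}" if "i \<in> {1..n}" "i \<noteq> m" for i
      using entry_in[OF perm that(1)] entry_eq_iff[OF perm that(1) m(1)] that(2) m(2) by auto
    have "?D \<subseteq> {2..n}"
      using ge2 m by auto
    moreover have "?U \<subseteq> {2..n}"
      using ge2 snd_m snd_n by (metis greaterThanAtMost_iff image_subset_iff less_irrefl subsetD)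
    moreover have "descents p \<inter> snd ` set H = {}"
      using snd_m m(3) by force
    hence "?D \<inter> ?U = {}"
      using inj_on_image_Int[OF inj[OF p] desc_n snd_n] by simp
    moreover have "card ?D = card ?U"
      using card_image[OF inj_on_subset[OF inj[OF p] desc_n]] card_image[OF inj_on_subset[OF inj[OF p] snd_n]]
        noncrossing_card(1)[OF H(2)] fst m(3) by simp
    moreover have "card {d\<in>?D. x \<le> d} \<le> card {u\<in>?U. x \<le> u}" for x
    proof -
      \<comment> \<open>Each hook that starts at height \<open>x\<close> or more ends higher still,
        and the ends are distinct.\<close>
      let ?T = "{h \<in> set H. x \<le> entry p (fst h)}"
      have T: "noncrossing ?T"
        by (rule noncrossing_subset[OF H(2)]) auto
      have "fst ` ?T = {i \<in> fst ` set H. x \<le> entry p i}"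
        by auto
      hence "fst ` ?T = {i \<in> descents p. x \<le> entry p i}"
        unfolding fst m(3) .
      hence "{d\<in>?D. x \<le> d} = entry p ` fst ` ?T"
        by auto
      hence "card {d\<in>?D. x \<le> d} \<le> card (fst ` ?T)"
        by (simp add: card_image_le)
      also have "\<dots> = card (snd ` ?T)"
        using noncrossing_card(1)[OF T] by simp
      also have "\<dots> = card (entry p ` snd ` ?T)"
        using snd_n by (intro card_image[symmetric] inj_on_subset[OF inj[OF p]]) auto
      also have "\<dots> \<le> card {u\<in>?U. x \<le> u}"
        using hook(5) by (intro card_mono) fastforce+
      finally show ?thesis .
    qed
    ultimately show "(?D, ?U) \<in> ballot_pairs n"
      by (simp add: ballot_pairs_def)
  next
    fix D U assume DU: "(D, U) \<in> ballot_pairs n"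
    have sub: "D \<subseteq> {2..n}" "U \<subseteq> {2..n}" "D \<inter> U = {}" and card: "card D = card U"
      and ballot: "\<And>x. card {d\<in>D. x \<le> d} \<le> card {u\<in>U. x \<le> u}"
      using DU by (auto simp: ballot_pairs_def)
    define p where "p = valley_list n D"
    have p: "p \<in> ?A" "entry p ` descents p = D"
      using valley_list_in_Av[OF sub(1) n] by (simp_all add: p_def)
    have perm: "p \<in> permutations_of_set {1..n}"
      using p perms by blast
    obtain m where m: "m \<in> {1..n}" "entry p m = 1" "descents p = {1..<m}"
      and dec: "\<And>i j. 1 \<le> i \<Longrightarrow> i < j \<Longrightarrow> j \<le> m \<Longrightarrow> entry p j < entry p i"
      and inc: "\<And>i j. m \<le> i \<Longrightarrow> i < j \<Longrightarrow> j \<le> n \<Longrightarrow> entry p i < entry p j"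
      using Av_132_231_valley[OF p(1) n] by metis
    define C where "C = {j\<in>{1..n}. entry p j \<in> U}"
    have C_gt: "m < c" "c \<le> n" if "c \<in> C" for c
    proof -
      have "c \<notin> descents p"
        using that sub(3) p(2) by (auto simp: C_def)
      moreover have "c \<noteq> m"
        using that sub(2) m(2) by (auto simp: C_def)
      ultimately show "m < c" "c \<le> n"
        using that m(3) by (auto simp: C_def)
    qed
    have C: "entry p ` C = U"
      using bij_betw_entry[OF perm] sub(2) by (fastforce simp: C_def bij_betw_def)
    have inj_C: "inj_on (entry p) C"
      by (rule inj_on_subset[OF inj[OF p(1)]]) (auto simp: C_def)
    have inj_D: "inj_on (entry p) {1..<m}"
      by (rule inj_on_subset[OF inj[OF p(1)]]) (use m(1) in auto)
    have card_C: "card C = m - 1"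
      using card_image[OF inj_C] card_image[OF inj_D] C p(2) m(3) card by simp
    have "\<exists>S. noncrossing S \<and> fst ` S = {1..<m} \<and> snd ` S = C"
    proof (rule noncrossing_exists)
      show "finite {1..<m}" "finite C" "card C = card {1..<m}"
        using card_C by (simp_all add: C_def)
      \<comment> \<open>In terms of positions this is only a matter of cardinality: every closer
        lies beyond every opener.\<close>
      show "\<forall>x. card {d \<in> {1..<m}. x \<le> d} \<le> card {c \<in> C. x < c}"
      proof
        fix x
        show "card {d \<in> {1..<m}. x \<le> d} \<le> card {c \<in> C. x < c}"
        proof (cases "x < m")
          case True
          hence "{c \<in> C. x < c} = C"
            using C_gt by force
          moreover have "card {d \<in> {1..<m}. x \<le> d} \<le> card {1..<m}"
            by (rule card_mono) auto
          ultimately show ?thesis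
            using card_C by simp
        next
          case False
          hence "{d \<in> {1..<m}. x \<le> d} = {}"
            by auto
          thus ?thesis
            by (metis card.empty zero_le)
        qed
      qed
    qed
    then obtain S where S: "noncrossing S" "fst ` S = {1..<m}" "snd ` S = C"
      by blast
    have fin: "finite S"
      using finite_imageD[OF _ noncrossing_inj_fst[OF S(1)]] S(2) by simp
    have in_S: "1 \<le> fst h" "fst h < m" "m < snd h" "snd h \<le> n" if "h \<in> S" for h
    proof -
      have "fst h \<in> {1..<m}" "snd h \<in> C"
        using S that by auto
      thus "1 \<le> fst h" "fst h < m" "m < snd h" "snd h \<le> n"
        using C_gt by auto
    qed
    text \<open>All hooks are nested, so the hooks whose northeast endpoint is higher than that of \<open>h\<close>
      start to the left of \<open>h\<close>; if \<open>h\<close> went down, there would be too few of them.\<close>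
    have up: "entry p (fst h) < entry p (snd h)" if h: "h \<in> S" for h
    proof (rule ccontr)
      assume "\<not> entry p (fst h) < entry p (snd h)"
      moreover have "entry p (fst h) \<noteq> entry p (snd h)"
        using entry_eq_iff[OF perm, of "fst h" "snd h"] in_S[OF h] by simp
      ultimately have down: "entry p (snd h) < entry p (fst h)"
        by simp
      let ?x = "entry p (fst h)"
      \<comment> \<open>The ballot condition at height \<open>?x\<close> thus demands
        \<open>fst h\<close> high closers, while the openers left of \<open>h\<close> supply at most
        \<open>fst h - 1\<close>.\<close>
      have "{d\<in>D. ?x \<le> d} \<supseteq> entry p ` {1..fst h}"
      proof safe
        fix i assume i: "i \<in> {1..fst h}"
        show "entry p i \<in> D"
          using i in_S[OF h] p(2) m(3) by auto
        show "?x \<le> entry p i"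
          using dec[of i "fst h"] i in_S[OF h] by (cases "i = fst h") auto
      qed
      moreover have "finite D"
        using sub(1) finite_subset by blast
      ultimately have "card (entry p ` {1..fst h}) \<le> card {d\<in>D. ?x \<le> d}"
        by (intro card_mono) auto
      moreover have "inj_on (entry p) {1..fst h}"
        by (rule inj_on_subset[OF inj_D]) (use in_S[OF h] in auto)
      ultimately have "fst h \<le> card {d\<in>D. ?x \<le> d}"
        by (simp add: card_image)
      also have "\<dots> \<le> card {u\<in>U. ?x \<le> u}"
        by (rule ballot)
      also have "{u\<in>U. ?x \<le> u} \<subseteq> entry p ` snd ` {h'\<in>S. fst h' < fst h}"
      proof
        fix u assume u: "u \<in> {u\<in>U. ?x \<le> u}"
        then obtain h' where h': "h' \<in> S" "u = entry p (snd h')"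
          using C S(3) by auto
        hence less: "entry p (snd h) < entry p (snd h')"
          using u down by simp
        hence "\<not> snd h' \<le> snd h"
          using inc[of "snd h'" "snd h"] in_S[OF h] in_S[OF h'(1)] by (cases "snd h' = snd h") auto
        hence "\<not> fst h < fst h'" "h' \<noteq> h"
          using noncrossing_cases[OF S(1) h h'(1)] in_S[OF h] in_S[OF h'(1)] by auto
        hence "fst h' < fst h"
          using inj_onD[OF noncrossing_inj_fst[OF S(1)] _ h'(1) h] by force
        thus "u \<in> entry p ` snd ` {h'\<in>S. fst h' < fst h}"
          using h' by blast
      qed
      hence "card {u\<in>U. ?x \<le> u} \<le> card (entry p ` snd ` {h'\<in>S. fst h' < fst h})"
        using fin by (intro card_mono) auto
      also have "\<dots> \<le> card {h'\<in>S. fst h' < fst h}"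
        using fin by (simp add: card_image_le order_trans[OF card_image_le])
      also have "\<dots> = card (fst ` {h'\<in>S. fst h' < fst h})"
        by (rule card_image[symmetric], rule inj_on_subset[OF noncrossing_inj_fst[OF S(1)]]) auto
      also have "\<dots> \<le> card {1..<fst h}"
        using in_S by (intro card_mono) auto
      finally show False
        using in_S[OF h] by simp
    qed
    have "snd h \<le> n \<and> dominating p h" if h: "h \<in> S" for h
      unfolding dominating_def
    proof (intro conjI ballI)
      show "snd h \<le> n"
        using in_S[OF h] by simp
      fix k assume k: "k \<in> {fst h..<snd h}"
      \<comment> \<open>Entries fall up to \<open>m\<close> and rise afterwards, so an entry under
        the hook is bounded by the left endpoint or lies on the rising run before
        \<open>snd h\<close>.\<close>
      show "entry p k < entry p (snd h)"
      proof (cases "k \<le> m")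
        case True
        hence "entry p k \<le> entry p (fst h)"
          using dec[of "fst h" k] k in_S[OF h] by (cases "k = fst h") auto
        thus ?thesis
          using up[OF h] by simp
      qed (use inc[of k "snd h"] k in_S[OF h] in auto)
    qed
    then obtain H where "(p, H) \<in> VHC ?A" "set H = S"
      using VHC_exists[OF perms p(1) S(1)] S(2) m(3) by metis
    thus "(D, U) \<in> (\<lambda>(p, H). (entry p ` descents p, entry p ` snd ` set H)) ` VHC ?A"
      using p(2) C S(3) by force
  qed
qed

section \<open>The map to pairs of Motzkin paths on permutations avoiding 231 and 312\<close>

text \<open>A block for consecutive members \<open>a > b\<close> of \<open>rs\<close> is the letter
  of \<open>a\<close> followed by one \<open>Down\<close> for each index strictly between them. The
  last member only ends the last block and has no letter of its own.\<close>

lemma concat_blocks: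
  assumes "sorted_wrt (>) rs" "rs \<noteq> []"
  shows "concat (map2 (\<lambda>a b. L a # replicate (a - b - 1) Down) rs (tl rs)) =
    map (\<lambda>i. if i \<in> set rs then L i else Down) (rev [Suc (last rs)..<Suc (hd rs)])"
  using assms
proof (induction rs)
  case (Cons a rs)
  show ?case
  proof (cases rs)
    case Nil
    thus ?thesis
      by simp
  next
    case (Cons b bs)
    have sorted: "sorted_wrt (>) rs" and less: "b < a" "\<forall>c\<in>set bs. c < b"
      using Cons.prems(1) by (auto simp: Cons)
    have last: "last rs \<le> b"
      using less(2) by (auto simp: Cons less_imp_le)
    let ?f = "\<lambda>rs i. if i \<in> set rs then L i else Down"
    have "[Suc (last rs)..<Suc a] = [Suc (last rs)..<Suc b] @ [Suc b..<a] @ [a]"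
      using upt_add_eq_append[of "Suc (last rs)" "Suc b" "a - b"] last less(1) by simp
    hence "map (?f (a # rs)) (rev [Suc (last rs)..<Suc a]) =
        ?f (a # rs) a # map (?f (a # rs)) (rev [Suc b..<a]) @ map (?f (a # rs)) (rev [Suc (last rs)..<Suc b])"
      by (simp del: upt_Suc)
    also have "map (?f (a # rs)) (rev [Suc b..<a]) = replicate (a - b - 1) Down"
    proof -
      have "map (?f (a # rs)) (rev [Suc b..<a]) = map (\<lambda>_. Down) (rev [Suc b..<a])"
        using less(2) by (intro map_cong refl) (auto simp: Cons)
      thus ?thesis
        by (simp add: map_replicate_const)
    qed
    also have "map (?f (a # rs)) (rev [Suc (last rs)..<Suc b]) = map (?f rs) (rev [Suc (last rs)..<Suc b])"
      using less(1) by (intro map_cong refl) auto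
    also have "\<dots> = concat (map2 (\<lambda>a b. L a # replicate (a - b - 1) Down) rs (tl rs))"
      using Cons.IH[OF sorted] by (simp add: Cons)
    finally show ?thesis
      by (simp add: Cons)
  qed
qed simp

lemma assemble_map:
  "assemble (map f xs) (map g xs) = concat (map (\<lambda>i. f i # replicate (g i) Down) xs)"
  by (simp add: assemble_def zip_map_map map2_map_map comp_def split_def zip_same_conv_map)

text \<open>Before \<open>m'\<close> nothing exceeds the maximum at \<open>m\<close>; from
  \<open>m'\<close> on nothing falls below it, since otherwise a 231 would arise from
  \<open>m\<close>, \<open>m'\<close> and that position. So the rank of the entry is
  \<open>m' - 1\<close>. The value \<open>m' = Suc n\<close> stands for the absence of a later
  maximum.\<close>

lemma entry_before_next_lr_max:
  assumes p: "p \<in> Av n {[2,3,1]}" and m: "m \<in> lr_max_positions p" and m': "m < m'" "m' \<le> Suc n"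
    and next_max: "m' \<le> n \<Longrightarrow> m' \<in> lr_max_positions p"
    and none: "lr_max_positions p \<inter> {m<..<m'} = {}"
  shows "entry p m = m' - 1"
proof -
  have perm: "p \<in> permutations_of_set {1..n}" and avoid: "\<not> contains_pattern p [2,3,1]"
    using p by (auto simp: Av_def)
  note len = length_permutation[OF perm]
  have m_in: "m \<in> {1..n}" and m_max: "\<And>k. 1 \<le> k \<Longrightarrow> k < m \<Longrightarrow> entry p k < entry p m"
    using m len by (auto simp: lr_max_positions_def)
  have below: "entry p j \<le> entry p m" if "1 \<le> j" "j < m'" for j
    using that
  proof (induction j rule: less_induct)
    case (less j)
    show ?case
    proof (cases "j \<le> m")
      case True
      thus ?thesis
        using m_max[of j] less by (cases "j = m") auto
    next
      case False
      hence "j \<notin> lr_max_positions p"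
        using none less by auto
      then obtain k where k: "1 \<le> k" "k < j" "entry p j \<le> entry p k"
        using less m' len by (auto simp: lr_max_positions_def not_less)
      thus ?thesis
        using less.IH[of k] less.prems by simp
    qed
  qed
  have above: "entry p m < entry p j" if "m' \<le> j" "j \<le> n" for j
  proof -
    have "m' \<in> lr_max_positions p"
      using next_max that by simp
    hence less: "entry p m < entry p m'"
      using m' m_in by (auto simp: lr_max_positions_def)
    have "\<not> entry p j < entry p m"
      using avoid[unfolded not_contains_231, rule_format, of m m' j] less that m' m_in len
      by (cases "j = m'") auto
    thus ?thesis
      using entry_eq_iff[OF perm, of j m] m_in m' that by auto
  qed
  have "{j \<in> {1..n}. entry p j \<le> entry p m} = {1..m' - 1}"
    using below above m' by (fastforce simp: not_less[symmetric])
  thus ?thesis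
    using entry_eq_card[OF perm m_in] by simp
qed

lemma mem_lr_max_positions_iff:
  assumes p: "p \<in> Av n {[3,1,2]}" and i: "2 \<le> i" "i \<le> n"
  shows "i \<in> lr_max_positions p \<longleftrightarrow> i \<notin> Suc ` descents p"
proof -
  have perm: "p \<in> permutations_of_set {1..n}"
    using in_AvD[OF p] .
  have "i \<in> Suc ` descents p \<longleftrightarrow> i - 1 \<in> descents p"
    using inj_image_mem_iff[OF inj_Suc, of "i - 1" "descents p"] i by simp
  moreover have "i \<in> lr_max_positions p \<longleftrightarrow> i - 1 \<notin> descents p"
  proof
    assume "i \<in> lr_max_positions p"
    hence "entry p (i - 1) < entry p i"
      using i by (auto simp: lr_max_positions_def)
    thus "i - 1 \<notin> descents p"
      using mem_descents_iff[OF perm, of "i - 1"] i by simp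
  next
    assume "i - 1 \<notin> descents p"
    thus "i \<in> lr_max_positions p"
      using ascent_top_of_Av_312[OF p] i length_permutation[OF perm] by (auto simp: lr_max_positions_def)
  qed
  ultimately show ?thesis
    by simp
qed

text \<open>Each left-to-right maximum except the last has height one less than the position of the
  next one, so the gaps in height repeat the gaps in position and both components spell the same
  word.\<close>

lemma LL_eq_ballot_path:
  assumes n: "n \<ge> 1" and VHC: "(p, H) \<in> VHC (Av n {[2,3,1], [3,1,2]})"
  defines "w \<equiv> ballot_path n (Suc ` descents p) (snd ` set H)"
  shows "LL (p, H) = (w, w)"
proof -
  let ?A = "Av n {[2,3,1], [3,1,2]}"
  have perms: "?A \<subseteq> permutations_of_set {1..n}"
    by (auto simp: Av_def)
  have p: "p \<in> ?A" and H: "map fst H = sorted_list_of_set (descents p)" "noncrossing (set H)"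
    and dom: "\<And>h. h \<in> set H \<Longrightarrow> snd h \<le> n \<and> dominating p h"
    using VHC unfolding mem_VHC_iff[OF perms] by blast+
  have perm: "p \<in> permutations_of_set {1..n}" and p231: "p \<in> Av n {[2,3,1]}" and p312: "p \<in> Av n {[3,1,2]}"
    using p by (auto simp: Av_def)
  note len = length_permutation[OF perm]
  define M where "M = lr_max_positions p"
  have M: "M \<subseteq> {1..n}" "finite M" and "1 \<in> M"
    using n len by (auto simp: M_def lr_max_positions_def)
  \<comment> \<open>A descent at \<open>n - 1\<close> would need a hook ending at \<open>n\<close>,
    which would have to go up along that descent.\<close>
  have "n \<in> M"
  proof (cases "n = 1")
    case False
    have "n - 1 \<notin> descents p"
    proof
      assume *: "n - 1 \<in> descents p"
      then obtain h where h: "h \<in> set H" "fst h = n - 1"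
        using fst_image_hooks[OF H(1)] by force
      have "snd h = n"
        using noncrossing_less[OF H(2) h(1)] conjunct1[OF dom[OF h(1)]] h(2) by linarith
      hence "entry p (n - 1) < entry p n"
        using dom[OF h(1)] noncrossing_less[OF H(2) h(1)] h(2) by (simp add: dominating_def)
      thus False
        using mem_descents_iff[OF perm, of "n - 1"] * n False by simp
    qed
    thus ?thesis
      using mem_lr_max_positions_iff[OF p312, of n] n False by (auto simp: M_def)
  qed (use \<open>1 \<in> M\<close> in simp)
  define rs where "rs = rev (sorted_list_of_set M)"
  have rs: "sorted_wrt (>) rs" "set rs = M" "rs \<noteq> []" and distinct: "distinct rs"
    using M(2) \<open>1 \<in> M\<close> by (auto simp: rs_def sorted_wrt_rev)
  have nth_less: "rs ! j < rs ! i" if "i < j" "j < length rs" for i j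
    using sorted_wrt_nth_less[OF rs(1) that] .
  have nth_M: "rs ! i \<in> M" if "i < length rs" for i
    using that rs(2) nth_mem by blast
  have len_rs: "length rs = Suc (ell p)"
    using rs(2,3) distinct_card[OF distinct] by (cases rs) (auto simp: ell_def M_def)
  have hd: "rs ! 0 = n"
  proof -
    obtain i where i: "i < length rs" "rs ! i = n"
      using \<open>n \<in> M\<close> rs(2) by (metis in_set_conv_nth)
    moreover have "rs ! 0 \<le> n"
      using nth_M[of 0] rs(3) M(1) by auto
    ultimately show ?thesis
      using nth_less[of 0 i] by (cases "i = 0") auto
  qed
  have last: "rs ! ell p = 1"
  proof -
    obtain i where i: "i < length rs" "rs ! i = 1"
      using \<open>1 \<in> M\<close> rs(2) by (metis in_set_conv_nth)
    moreover have "1 \<le> rs ! ell p"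
      using nth_M[of "ell p"] len_rs M(1) by auto
    ultimately show ?thesis
      using nth_less[of i "ell p"] len_rs by (cases "i = ell p") auto
  qed
  have lr: "lr_max p i = point p (rs ! i)" if "i \<le> ell p" for i
    using that len_rs by (simp add: lr_max_def rs_def M_def nth_append rev_map)
  have lr_last: "lr_max p (Suc (ell p)) = (0, 0)"
    using len_rs by (simp add: lr_max_def rs_def M_def nth_append rev_map)
  text \<open>In a block the entries are the positions in reverse order, so the highest entry of
    a block is its last position.\<close>
  have top: "entry p (rs ! Suc i) = rs ! i - 1" if "i < ell p" for i
  proof (rule entry_before_next_lr_max[OF p231])
    show "rs ! Suc i \<in> lr_max_positions p" "rs ! i \<in> lr_max_positions p"
      using nth_M[of i] nth_M[of "Suc i"] that len_rs by (simp_all add: M_def)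
    show "rs ! Suc i < rs ! i"
      using nth_less[of i "Suc i"] that len_rs by simp
    show "rs ! i \<le> Suc n"
      using nth_M[of i] M(1) that len_rs by fastforce
    show "lr_max_positions p \<inter> {rs ! Suc i<..<rs ! i} = {}"
    proof (rule ccontr)
      assume "lr_max_positions p \<inter> {rs ! Suc i<..<rs ! i} \<noteq> {}"
      then obtain k where k: "k < length rs" "rs ! Suc i < rs ! k" "rs ! k < rs ! i"
        using rs(2) by (auto simp: M_def[symmetric] in_set_conv_nth)
      hence "\<not> k \<le> i" "\<not> Suc i \<le> k"
        using nth_less[of k i] nth_less[of "Suc i" k] that len_rs
        by (auto simp: le_less)
      thus False
        by simp
    qed
  qed
  have gap_x: "gap_x p (Suc i) = rs ! i - rs ! Suc i - 1" if i: "i < ell p" for i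
  proof -
    have "{q \<in> plot p. rs ! Suc i < fst q \<and> fst q < rs ! i} = point p ` {rs ! Suc i<..<rs ! i}"
      using nth_M[of i] M(1) that len_rs len by (fastforce simp: plot_def point_def)
    moreover have "card (point p ` X) = card X" for X
      by (rule card_image) (auto simp: inj_on_def point_def)
    moreover have "gap_x p (Suc i) = card {q \<in> plot p. rs ! Suc i < fst q \<and> fst q < rs ! i}"
      using i lr[of i] lr[of "Suc i"] by (simp add: gap_x_def point_def)
    ultimately show ?thesis
      by simp
  qed
  have card_heights: "card {q \<in> plot p. a < snd q \<and> snd q < b} = b - a - 1" if "b \<le> Suc n" for a b
  proof -
    have "inj_on snd (plot p)"
      using entry_eq_iff[OF perm] len by (auto simp: inj_on_def plot_def point_def)
    hence card: "card {q \<in> plot p. a < snd q \<and> snd q < b} = card (snd ` {q \<in> plot p. a < snd q \<and> snd q < b})"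
      by (intro card_image[symmetric]) (auto simp: inj_on_def)
    have "snd ` plot p = {1..n}"
      using bij_betw_entry[OF perm] len by (simp add: plot_def image_image point_def bij_betw_def)
    hence "{y \<in> snd ` plot p. a < y \<and> y < b} = {a<..<b}"
      using that by auto
    moreover have "snd ` {q \<in> plot p. a < snd q \<and> snd q < b} = {y \<in> snd ` plot p. a < y \<and> y < b}"
      by auto
    ultimately show ?thesis
      by (simp add: card)
  qed
  have gap_y: "gap_y p (Suc i) = rs ! i - rs ! Suc i - 1" if i: "i < ell p" for i
  proof -
    \<comment> \<open>The conventional point \<open>(0, 0)\<close> fits the general formula because
      the leftmost maximum is at position 1.\<close>
    have next_height: "snd (lr_max p (Suc (Suc i))) = rs ! Suc i - 1"
    proof (cases "Suc i = ell p")
      case True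
      thus ?thesis
        using lr_last last by simp
    next
      case False
      thus ?thesis
        using i top[of "Suc i"] lr[of "Suc (Suc i)"] by (simp add: point_def)
    qed
    have height: "snd (lr_max p (Suc i)) = rs ! i - 1"
      using i top[of i] lr[of "Suc i"] by (simp add: point_def)
    have "rs ! i - 1 \<le> Suc n"
      using nth_M[of i] M(1) i len_rs by fastforce
    moreover have "1 \<le> rs ! Suc i"
      using nth_M[of "Suc i"] M(1) i len_rs by fastforce
    ultimately show ?thesis
      using card_heights[of "rs ! i - 1" "rs ! Suc i - 1"] next_height height
      by (simp add: gap_y_def)
  qed
  define L where "L i = (if i \<in> snd ` set H then Up else East)" for i
  have letter: "letter p H (Suc i) = L (rs ! i)" if "i < ell p" for i
  proof -
    have "lr_max p i \<in> ne p ` set H \<longleftrightarrow> rs ! i \<in> snd ` set H"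
      using lr[of i] that by (force simp: ne_def point_def)
    thus ?thesis
      by (simp add: letter_def L_def)
  qed
  \<comment> \<open>Stated for an arbitrary gap function, so that it applies to both
    components.\<close>
  have eq: "concat (map (\<lambda>i. letter p H i # replicate (g i) Down) [1..<ell p + 1]) = w"
    if g: "\<And>i. i < ell p \<Longrightarrow> g (Suc i) = rs ! i - rs ! Suc i - 1" for g
  proof -
    have "map (\<lambda>i. letter p H i # replicate (g i) Down) [1..<ell p + 1] =
        map2 (\<lambda>a b. L a # replicate (a - b - 1) Down) rs (tl rs)"
      by (rule nth_equalityI)
        (use len_rs letter g in \<open>auto simp: nth_tl simp del: upt_Suc\<close>)
    hence "concat (map (\<lambda>i. letter p H i # replicate (g i) Down) [1..<ell p + 1]) =
        map (\<lambda>i. if i \<in> set rs then L i else Down) (rev [Suc (last rs)..<Suc (hd rs)])"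
      using concat_blocks[OF rs(1,3)] by simp
    also have "last rs = 1"
      using last rs(3) len_rs by (simp add: last_conv_nth)
    also have "hd rs = n"
      using hd rs(3) by (simp add: hd_conv_nth)
    also have "map (\<lambda>i. if i \<in> set rs then L i else Down) (rev [Suc 1..<Suc n]) = w"
      unfolding w_def ballot_path_def numeral_2_eq_2 One_nat_def
      using mem_lr_max_positions_iff[OF p312]
      by (intro map_cong refl) (auto simp: rs(2) M_def L_def simp del: upt_Suc)
    finally show ?thesis .
  qed
  show ?thesis
    using eq[OF gap_x] eq[OF gap_y] by (simp add: LL_def Let_def assemble_map del: upt_Suc)
qed

theorem theorem3:
  fixes n :: nat
  assumes "n \<ge> 1"
  shows "VHC (Av n {[2,3,1], [3,1,2]}) \<subseteq> VHC (Av n {[3,1,2]}) \<and>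
         Int_motzkin_A (n - 1) \<subseteq> Int_motzkin_C (n - 1) \<and>
         bij_betw LL (VHC (Av n {[2,3,1], [3,1,2]})) (Int_motzkin_A (n - 1)) \<and>
         card (VHC (Av n {[1,3,2], [2,3,1]})) = motzkin_number (n - 1) \<and>
         card (VHC (Av n {[1,3,2], [3,1,2]})) = motzkin_number (n - 1) \<and>
         card (VHC (Av n {[2,3,1], [3,1,2]})) = motzkin_number (n - 1)"
proof (intro conjI)
  show "VHC (Av n {[2,3,1], [3,1,2]}) \<subseteq> VHC (Av n {[3,1,2]})"
    by (auto simp: VHC_def Av_def)
  show "Int_motzkin_A (n - 1) \<subseteq> Int_motzkin_C (n - 1)"
    by (auto simp: Int_motzkin_A_def Int_motzkin_C_def intervals_def le_C_def le_S_def)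
  have card_ballot: "card (ballot_pairs n) = motzkin_number (n - 1)"
    unfolding motzkin_number_def by (rule bij_betw_same_card[OF bij_betw_ballot_path[OF assms]])
  have bij: "bij_betw (\<lambda>(p, H). (Suc ` descents p, snd ` set H)) (VHC (Av n {[2,3,1], [3,1,2]})) (ballot_pairs n)"
    by (rule bij_betw_VHC_ballot_pairs[OF _ bij_betw_descents_Av_231_312]) (auto simp: Av_def)
  show "card (VHC (Av n {[2,3,1], [3,1,2]})) = motzkin_number (n - 1)"
    using bij_betw_same_card[OF bij] card_ballot by simp
  have "bij_betw (\<lambda>(p, H). (Suc ` descents p, snd ` set H)) (VHC (Av n {[1,3,2], [3,1,2]})) (ballot_pairs n)"
    by (rule bij_betw_VHC_ballot_pairs[OF _ bij_betw_descents_Av_132_312]) (auto simp: Av_def)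
  from bij_betw_same_card[OF this]
  show "card (VHC (Av n {[1,3,2], [3,1,2]})) = motzkin_number (n - 1)"
    using card_ballot by simp
  show "card (VHC (Av n {[1,3,2], [2,3,1]})) = motzkin_number (n - 1)"
    using bij_betw_same_card[OF bij_betw_VHC_Av_132_231[OF assms]] card_ballot by simp
  \<comment> \<open>Intervals of an antichain form the diagonal. Composed with the two earlier
    bijections, this map sends a configuration to its path taken twice, which is the value of
    \<open>LL\<close>.\<close>
  have "bij_betw (\<lambda>w. (w, w)) (motzkin_paths (n - 1)) (Int_motzkin_A (n - 1))"
    by (rule bij_betwI[of _ _ _ fst]) (auto simp: Int_motzkin_A_def intervals_def)
  from bij_betw_trans[OF bij_betw_trans[OF bij bij_betw_ballot_path[OF assms]] this]
  show "bij_betw LL (VHC (Av n {[2,3,1], [3,1,2]})) (Int_motzkin_A (n - 1))"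
    by (rule iffD1[OF bij_betw_cong, rotated]) (auto simp: LL_eq_ballot_path[OF assms])
qed

end
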